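(* Let $\lambda=(\lambda_1\ge\lambda_2)$ be a dominant weight of $\mathfrak{gl}_2(\mathbb{C})$, put $m=\lambda_1-\lambda_2$, and let $D_\lambda(u)=\det(\Omega_\lambda(u)-L)$ be the shifted determinant of the braided Casimir element $\Omega_\lambda$, written as the explicit tridiagonal matrix given in the context. Then: (a) The polynomial $D_\lambda(u)$ is central, i.e. all its coefficients (as a polynomial in $u$) lie in the center $Z(\mathfrak{gl}_2(\mathbb{C}))$ of $U(\mathfrak{gl}_2(\mathbb{C}))$. (b) Let $\mu=(\mu_1\ge\mu_2)$ be another dominant weight of $\mathfrak{gl}_2(\mathbb{C})$. The image of $D_\lambda(u)$ under the Harish-Chandra isomorphism $\chi$ is the following function of $\mu$: $$\chi(D_\lambda(u))=\prod_{k=0}^{m}\bigl(u+(\lambda_1-k)\mu_1+(\lambda_2+k)\mu_2-k\bigr).$$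
   Context: $E_{ij}$ ($i,j\in\{1,2\}$) are the standard matrix units of $\mathfrak{gl}_2(\mathbb{C})$ and $U(\mathfrak{gl}_2(\mathbb{C}))$ is its universal enveloping algebra. A dominant weight is a pair $\lambda=(\lambda_1,\lambda_2)$ with $\lambda_1-\lambda_2\in\mathbb{Z}_{+}=\{0,1,2,\dots\}$; $\pi_\lambda$ is the corresponding irreducible representation, on a space $V_\lambda$ of dimension $m+1$. The braided Casimir element is $\Omega_\lambda=\sum_{i,j}E_{ij}\otimes\pi_\lambda(E_{ji})\in U(\mathfrak{gl}_2(\mathbb{C}))\otimes\mathrm{End}(V_\lambda)$, viewed as an $(m+1)\times(m+1)$ matrix over $U(\mathfrak{gl}_2(\mathbb{C}))$. In the basis of $V_\lambda$ used here it is the tridiagonal matrix whose only nonzero entries are $$[\Omega_\lambda]_{k,k}=(\lambda_1-k+1)E_{11}+(\lambda_2+k-1)E_{22}\quad(k=1,\dots,m+1),$$ $$[\Omega_\lambda]_{k,k+1}=(m+1-k)E_{21},\qquad [\Omega_\lambda]_{k+1,k}=kE_{12}\quad(k=1,\dots,m).$$ Put $\Omega_\lambda(u)=\Omega_\lambda+u\otimes\mathrm{id}$ (i.e. $u$ is added to each diagonal entry) and $L=\mathrm{diag}(m,m-1,\dots,0)$. For an $(m+1)\times(m+1)$ matrix $A$ with entries $A_{ij}$ in a possibly non-commutative algebra, $\det$ denotes the column-determinant $$\det(A)=\sum_{\sigma\in S_{m+1}}(-1)^{\sigma}A_{\sigma(1)1}A_{\sigma(2)2}\cdots A_{\sigma(m+1)(m+1)},$$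 where $(-1)^\sigma$ is the sign of $\sigma$. The Harish-Chandra isomorphism $\chi$ sends a central element $z$ to the function of $\mu$ whose value is the scalar by which $z$ acts on the irreducible representation of highest weight $\mu$ (for the highest weight vector $v$: $E_{12}v=0$, $E_{ii}v=\mu_i v$). It is applied to polynomials in $u$ coefficientwise. *)

theory Defs
  imports
    "HOL-Analysis.Finite_Cartesian_Product"
    "HOL-Library.Poly_Mapping"
    "HOL-Library.Numeral_Type"
    "HOL-Combinatorics.Permutations"
    "Jordan_Normal_Form.VS_Connect"
begin

section \<open>The universal enveloping algebra of \<open>gl\<^sub>2(\<complex>)\<close>\<close>

text \<open>
  The free monoid, written additively so that \<open>'a free_word \<Rightarrow>\<^sub>0 complex\<close> is, with the
  convolution product of \<^theory>\<open>HOL-Library.Poly_Mapping\<close>, the free associative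
  algebra over the complex numbers on the set of generators \<open>'a\<close>.
\<close>

datatype 'a free_word = Word (letters: "'a list")

instantiation free_word :: (type) monoid_add
begin

definition zero_free_word :: "'a free_word" where
  "0 = Word []"

definition plus_free_word :: "'a free_word \<Rightarrow> 'a free_word \<Rightarrow> 'a free_word" where
  "v + w = Word (letters v @ letters w)"

instance
  by standard (simp_all add: zero_free_word_def plus_free_word_def)

end

lemma free_word_add_eq_0_iff: "v + w = 0 \<longleftrightarrow> v = 0 \<and> w = 0"
  for v w :: "'a free_word"
  by (cases v; cases w) (simp add: zero_free_word_def plus_free_word_def)

type_synonym gl2 = "complex ^ 2 ^ 2"

type_synonym free_gl2 = "gl2 free_word \<Rightarrow>\<^sub>0 complex"

definition free_gen :: "gl2 \<Rightarrow> free_gl2" where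
  "free_gen x = Poly_Mapping.single (Word [x]) 1"

text \<open>
  The first two families of relations make the generators depend linearly on the element of
  \<open>gl\<^sub>2\<close>, which cuts the free algebra on the set \<open>gl\<^sub>2\<close> down to the tensor
  algebra; the third one is \<open>x y - y x = [x, y]\<close>.
\<close>

definition ug_relators :: "free_gl2 set" where
  "ug_relators =
     {free_gen (x + y) - free_gen x - free_gen y | x y. True} \<union>
     {free_gen (\<chi> i j. c * x $ i $ j) - Poly_Mapping.single 0 c * free_gen x | c x. True} \<union>
     {free_gen x * free_gen y - free_gen y * free_gen x - free_gen (x ** y - y ** x) | x y. True}"

inductive_set two_sided_ideal :: "'a::ring_1 set \<Rightarrow> 'a set" for R where
  zero: "0 \<in> two_sided_ideal R"
| add: "p \<in> two_sided_ideal R \<Longrightarrow> q \<in> two_sided_ideal R \<Longrightarrow> p + q \<in> two_sided_ideal R"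
| gen: "r \<in> R \<Longrightarrow> a * r * b \<in> two_sided_ideal R"

lemma two_sided_ideal_mult:
  assumes "p \<in> two_sided_ideal R"
  shows "a * p * b \<in> two_sided_ideal R"
  using assms
proof induction
  case (gen r c d)
  then show ?case
    using two_sided_ideal.gen[OF gen, of "a * c" "d * b"] by (simp add: mult.assoc)
qed (auto simp: distrib_left distrib_right intro: two_sided_ideal.intros)

lemma two_sided_ideal_minus: "p \<in> two_sided_ideal R \<Longrightarrow> - p \<in> two_sided_ideal R"
  using two_sided_ideal_mult[of p R "- 1" 1] by simp

lemma two_sided_ideal_diff:
  "p \<in> two_sided_ideal R \<Longrightarrow> q \<in> two_sided_ideal R \<Longrightarrow> p - q \<in> two_sided_ideal R"
  using two_sided_ideal.add[of p R "- q"] two_sided_ideal_minus[of q R] by simp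

definition ug_rel :: "free_gl2 \<Rightarrow> free_gl2 \<Rightarrow> bool" where
  "ug_rel p q \<longleftrightarrow> p - q \<in> two_sided_ideal ug_relators"

lemma equivp_ug_rel: "equivp ug_rel"
proof (rule equivpI)
  show "reflp ug_rel"
    by (auto simp: reflp_def ug_rel_def intro: two_sided_ideal.zero)
  show "symp ug_rel"
    unfolding symp_def ug_rel_def by (metis minus_diff_eq two_sided_ideal_minus)
  show "transp ug_rel"
  proof (rule transpI)
    fix p q r :: free_gl2
    assume "ug_rel p q" "ug_rel q r"
    then have "(p - q) + (q - r) \<in> two_sided_ideal ug_relators"
      unfolding ug_rel_def by (rule two_sided_ideal.add)
    then show "ug_rel p r"
      by (simp add: ug_rel_def)
  qed
qed

text \<open>
  The coefficient of the empty word is multiplicative and vanishes on the ideal, so the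
  quotient is not the zero ring.
\<close>

lemma lookup_mult_zero:
  fixes p q :: "'a free_word \<Rightarrow>\<^sub>0 'b::ring_1"
  shows "Poly_Mapping.lookup (p * q) 0 = Poly_Mapping.lookup p 0 * Poly_Mapping.lookup q 0"
proof -
  have "Poly_Mapping.lookup (p * q) 0 =
      (\<Sum>(a, b). Poly_Mapping.lookup p a * Poly_Mapping.lookup q b when (0::'a free_word) = a + b)"
    unfolding times_poly_mapping.rep_eq by (rule prod_fun_unfold_prod) simp_all
  also have "\<dots> = (\<Sum>ab. Poly_Mapping.lookup p 0 * Poly_Mapping.lookup q 0 when ab = (0 :: 'a free_word, 0 :: 'a free_word))"
    by (rule arg_cong[where f = Sum_any])
       (auto simp: fun_eq_iff when_def eq_commute[of "0 :: 'a free_word"] free_word_add_eq_0_iff)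
  also have "\<dots> = Poly_Mapping.lookup p 0 * Poly_Mapping.lookup q 0"
    by simp
  finally show ?thesis .
qed

lemma lookup_zero_two_sided_ideal:
  assumes "p \<in> two_sided_ideal ug_relators"
  shows "Poly_Mapping.lookup p 0 = 0"
  using assms
proof induction
  case (gen r a b)
  have g: "Poly_Mapping.lookup (free_gen x) 0 = 0" for x
    by (simp add: free_gen_def lookup_single zero_free_word_def)
  have "Poly_Mapping.lookup r 0 = 0"
    using gen by (auto simp: ug_relators_def lookup_minus lookup_mult_zero g)
  then show ?case
    by (simp add: lookup_mult_zero)
qed (simp_all add: lookup_add)

quotient_type ugl2 = free_gl2 / ug_rel
  by (rule equivp_ug_rel)

instantiation ugl2 :: ring_1
begin

lift_definition zero_ugl2 :: ugl2 is 0 .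

lift_definition one_ugl2 :: ugl2 is 1 .

lift_definition plus_ugl2 :: "ugl2 \<Rightarrow> ugl2 \<Rightarrow> ugl2" is "(+)"
proof -
  fix p p' q q' :: free_gl2
  assume "ug_rel p p'" "ug_rel q q'"
  then have "(p - p') + (q - q') \<in> two_sided_ideal ug_relators"
    unfolding ug_rel_def by (rule two_sided_ideal.add)
  then show "ug_rel (p + q) (p' + q')"
    by (simp add: ug_rel_def algebra_simps)
qed

lift_definition uminus_ugl2 :: "ugl2 \<Rightarrow> ugl2" is uminus
proof -
  fix p p' :: free_gl2
  assume "ug_rel p p'"
  then have "- (p - p') \<in> two_sided_ideal ug_relators"
    unfolding ug_rel_def by (rule two_sided_ideal_minus)
  then show "ug_rel (- p) (- p')"
    by (simp add: ug_rel_def algebra_simps)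
qed

lift_definition minus_ugl2 :: "ugl2 \<Rightarrow> ugl2 \<Rightarrow> ugl2" is "(-)"
proof -
  fix p p' q q' :: free_gl2
  assume "ug_rel p p'" "ug_rel q q'"
  then have "(p - p') - (q - q') \<in> two_sided_ideal ug_relators"
    unfolding ug_rel_def by (rule two_sided_ideal_diff)
  then show "ug_rel (p - q) (p' - q')"
    by (simp add: ug_rel_def algebra_simps)
qed

lift_definition times_ugl2 :: "ugl2 \<Rightarrow> ugl2 \<Rightarrow> ugl2" is "(*)"
proof -
  fix p p' q q' :: free_gl2
  assume "ug_rel p p'" "ug_rel q q'"
  then have "1 * (p - p') * q + p' * (q - q') * 1 \<in> two_sided_ideal ug_relators"
    unfolding ug_rel_def by (intro two_sided_ideal.add two_sided_ideal_mult)
  then show "ug_rel (p * q) (p' * q')"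
    by (simp add: ug_rel_def algebra_simps)
qed

instance
proof
  show "(0::ugl2) \<noteq> 1"
    by transfer (auto simp: ug_rel_def lookup_minus dest!: lookup_zero_two_sided_ideal)
qed (transfer, simp add: ug_rel_def algebra_simps two_sided_ideal.zero)+

end

lift_definition uscale :: "complex \<Rightarrow> ugl2 \<Rightarrow> ugl2"
  is "\<lambda>c p. Poly_Mapping.single 0 c * p"
proof -
  fix c :: complex and p q :: free_gl2
  assume "ug_rel p q"
  then have "Poly_Mapping.single 0 c * (p - q) * 1 \<in> two_sided_ideal ug_relators"
    unfolding ug_rel_def by (rule two_sided_ideal_mult)
  then show "ug_rel (Poly_Mapping.single 0 c * p) (Poly_Mapping.single 0 c * q)"
    by (simp add: ug_rel_def algebra_simps)
qed

lift_definition ug_incl :: "gl2 \<Rightarrow> ugl2" is free_gen .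

text \<open>The matrix units; the index type \<^typ>\<open>2\<close> has the two elements 1 and 2.\<close>

definition E :: "2 \<Rightarrow> 2 \<Rightarrow> ugl2" where
  "E i j = ug_incl (axis i (axis j 1))"

definition ug_center :: "ugl2 set" where
  "ug_center = {z. \<forall>x. z * x = x * z}"


section \<open>The braided Casimir element and its shifted determinant\<close>

definition col_det :: "'a::ring_1 mat \<Rightarrow> 'a" where
  "col_det A = (\<Sum>p | p permutes {0..<dim_col A}.
      of_int (sign p) * prod_list (map (\<lambda>j. A $$ (p j, j)) [0..<dim_col A]))"

text \<open>
  The matrix of the sum over i, j of \<open>E\<^sub>i\<^sub>j \<otimes> \<pi>(E\<^sub>j\<^sub>i)\<close>, where \<open>\<pi>\<close> is the irreducible
  representation of highest weight \<open>(l1, l2)\<close> in the basis \<open>v\<^sub>0, \<dots>, v\<^sub>m\<close> of weight vectors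
  with \<open>\<pi>(E\<^sub>2\<^sub>1) v\<^sub>i = (i + 1) v\<^sub>i\<^sub>+\<^sub>1\<close> and \<open>\<pi>(E\<^sub>1\<^sub>2) v\<^sub>i\<^sub>+\<^sub>1 = (m - i) v\<^sub>i\<close>; here \<open>m = l1 - l2\<close>.
  Rows and columns are numbered from 0, so the index k of the usual 1-based formulas
  is \<open>i + 1\<close> on the diagonal and above it, and \<open>j + 1\<close> below it.
\<close>

definition braided_casimir :: "complex \<Rightarrow> complex \<Rightarrow> nat \<Rightarrow> ugl2 mat" where
  "braided_casimir l1 l2 m = Matrix.mat (m + 1) (m + 1) (\<lambda>(i, j).
     if i = j then uscale (l1 - of_nat i) (E 1 1) + uscale (l2 + of_nat i) (E 2 2)
     else if j = i + 1 then uscale (of_nat (m - i)) (E 2 1)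
     else if i = j + 1 then uscale (of_nat (j + 1)) (E 1 2)
     else 0)"

text \<open>
  Polynomials in the central variable u over \<^typ>\<open>ugl2\<close> are represented by
  \<^typ>\<open>nat \<Rightarrow>\<^sub>0 ugl2\<close>, because the product of \<^typ>\<open>'a poly\<close> is only available for
  commutative coefficients. The coefficient of \<open>u ^ n\<close> in p is \<open>Poly_Mapping.lookup p n\<close>.
\<close>

definition upoly_const :: "ugl2 \<Rightarrow> (nat \<Rightarrow>\<^sub>0 ugl2)" where
  "upoly_const a = Poly_Mapping.single 0 a"

definition upoly_var :: "nat \<Rightarrow>\<^sub>0 ugl2" where
  "upoly_var = Poly_Mapping.single 1 1"

definition braided_casimir_u :: "complex \<Rightarrow> complex \<Rightarrow> nat \<Rightarrow> (nat \<Rightarrow>\<^sub>0 ugl2) mat" where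
  "braided_casimir_u l1 l2 m =
     map_mat upoly_const (braided_casimir l1 l2 m) + upoly_var \<cdot>\<^sub>m 1\<^sub>m (m + 1)"

definition shift_L :: "nat \<Rightarrow> (nat \<Rightarrow>\<^sub>0 ugl2) mat" where
  "shift_L m = Matrix.mat (m + 1) (m + 1) (\<lambda>(i, j). if i = j then of_nat (m - i) else 0)"

definition shifted_det :: "complex \<Rightarrow> complex \<Rightarrow> nat \<Rightarrow> (nat \<Rightarrow>\<^sub>0 ugl2)" where
  "shifted_det l1 l2 m = col_det (braided_casimir_u l1 l2 m - shift_L m)"


section \<open>Highest weight representations and the Harish-Chandra map\<close>

text \<open>
  Finite-dimensional representations of \<open>gl\<^sub>2\<close> are unital algebra homomorphisms from its
  enveloping algebra to n by n complex matrices.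
\<close>

definition ug_rep :: "nat \<Rightarrow> (ugl2 \<Rightarrow> complex mat) \<Rightarrow> bool" where
  "ug_rep n \<rho> \<longleftrightarrow>
     (\<forall>x. \<rho> x \<in> carrier_mat n n) \<and>
     \<rho> 1 = 1\<^sub>m n \<and>
     (\<forall>x y. \<rho> (x * y) = \<rho> x * \<rho> y) \<and>
     (\<forall>x y. \<rho> (x + y) = \<rho> x + \<rho> y) \<and>
     (\<forall>c x. \<rho> (uscale c x) = c \<cdot>\<^sub>m \<rho> x)"

definition ug_irreducible :: "nat \<Rightarrow> (ugl2 \<Rightarrow> complex mat) \<Rightarrow> bool" where
  "ug_irreducible n \<rho> \<longleftrightarrow> ug_rep n \<rho> \<and> n > 0 \<and>
     (\<forall>W. VectorSpace.subspace class_ring W (module_vec TYPE(complex) n) \<longrightarrow>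
        (\<forall>x. \<forall>w\<in>W. \<rho> x *\<^sub>v w \<in> W) \<longrightarrow> W = {0\<^sub>v n} \<or> W = carrier_vec n)"

definition has_highest_weight :: "nat \<Rightarrow> (ugl2 \<Rightarrow> complex mat) \<Rightarrow> complex \<times> complex \<Rightarrow> bool" where
  "has_highest_weight n \<rho> \<mu> \<longleftrightarrow> (\<exists>v\<in>carrier_vec n. v \<noteq> 0\<^sub>v n \<and>
     \<rho> (E 1 2) *\<^sub>v v = 0\<^sub>v n \<and>
     \<rho> (E 1 1) *\<^sub>v v = fst \<mu> \<cdot>\<^sub>v v \<and>
     \<rho> (E 2 2) *\<^sub>v v = snd \<mu> \<cdot>\<^sub>v v)"

text \<open>
  The scalar by which z acts on the irreducible representation of highest weight \<open>\<mu>\<close>, which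
  is only determined up to isomorphism, whence the quantification over all of its matrix
  realizations. Meaningful for central z and dominant \<open>\<mu>\<close>.
\<close>

definition harish_chandra :: "ugl2 \<Rightarrow> complex \<times> complex \<Rightarrow> complex" where
  "harish_chandra z \<mu> = (THE c. \<forall>n \<rho>.
     ug_irreducible n \<rho> \<and> has_highest_weight n \<rho> \<mu> \<longrightarrow> \<rho> z = c \<cdot>\<^sub>m 1\<^sub>m n)"

end

(*
  A permutation contributing to the column determinant of a tridiagonal matrix is a product of
  disjoint adjacent transpositions, so the determinant is a continuant in the products
  A(j+1,j) A(j,j+1), here multiples of P = E12 E21, and in the diagonal entries x - j K, where
  K = E11 - E22 - 1 and x = l1 E11 + l2 E22 + u - m.  These elements commute, so identities from
  commutative algebra apply.

  The generating function sum_k D_k t^k / k! of the continuants with parameter m is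
  (1 + a t)^A (1 + b t)^B, where a + b = K, a b = -P, A + B = m and A a + B b = x.
  Removing one factor 1 + a t gives a recursion that leads to the product of the
  x - k a - (m - k) b; removing 1 + K t - P t^2 gives
  D_{m+1}(x, m) = (x (x - m K) - m^2 P) D_{m-1}(x - K, m - 2).
  Four times the quadratic factor is (2x - mK)^2 - m^2 (K^2 + 4P), and both 2x - mK and the Casimir
  element K^2 + 4P are central; this gives (a).  On a highest weight vector P acts as mu1 - mu2 and
  K as mu1 - mu2 - 1, so a = mu1 - mu2 and b = -1; this gives (b), because a central element acts
  on an irreducible representation by its value on one vector.  That the Harish-Chandra value is
  well defined needs one irreducible representation of highest weight mu.
*)

theory Submission
  imports Defs "HOL-Analysis.Cartesian_Space"
begin

section \<open>Continuants and tridiagonal column determinants\<close>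

text \<open>Leading minors of a tridiagonal matrix with diagonal \<open>x - j K\<close> and opposite
  off-diagonal products \<open>(j + 1) (M - j) P\<close>. The parameter \<open>M\<close> is a ring
  element, so that it can be lowered by 1 or 2. New factors go on the right, as later columns do in
  a column determinant.\<close>

fun continuant :: "'a::ring_1 \<Rightarrow> 'a \<Rightarrow> 'a \<Rightarrow> 'a \<Rightarrow> nat \<Rightarrow> 'a" where
  "continuant M x K P 0 = 1"
| "continuant M x K P (Suc 0) = x"
| "continuant M x K P (Suc (Suc k)) =
     continuant M x K P (Suc k) * (x - of_nat (Suc k) * K)
     - continuant M x K P k * (of_nat (Suc k) * (M - of_nat k) * P)"

text \<open>Multiplication of the exponential generating function by \<open>1 + a t\<close>.\<close>

lemma continuant_shift:
  fixes M x a b :: "'a::comm_ring_1"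
  shows "continuant M x (a + b) (- (a * b)) (Suc k) =
    continuant (M - 1) (x - a) (a + b) (- (a * b)) (Suc k)
    + of_nat (Suc k) * a * continuant (M - 1) (x - a) (a + b) (- (a * b)) k"
proof (induction k rule: induct_nat_012)
  case 0
  then show ?case by simp
next
  case 1
  then show ?case by (simp add: algebra_simps)
next
  case (ge2 k)
  show ?case
    unfolding continuant.simps(3)[of M x _ _ "Suc k"] ge2
    by (simp add: algebra_simps)
qed

text \<open>For \<open>M = m + 1\<close>, the recursion that expresses order \<open>m + 2\<close> of
  the shifted continuant has off-diagonal coefficient 0. Both terms of
  \<open>continuant_shift\<close> are then multiples of the one of order \<open>m + 1\<close>, with
  common factor \<open>x - (m + 1) b\<close>; the induction supplies the other factors, with
  \<open>k\<close> raised by one.\<close>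

lemma continuant_eq_prod:
  fixes x a b :: "'a::comm_ring_1"
  shows "continuant (of_nat m) x (a + b) (- (a * b)) (Suc m) =
    (\<Prod>k\<le>m. x - of_nat k * a - of_nat (m - k) * b)"
proof (induction m arbitrary: x)
  case 0
  then show ?case by simp
next
  case (Suc m)
  have "continuant (of_nat (Suc m)) x (a + b) (- (a * b)) (Suc (Suc m)) =
      (x - of_nat (Suc m) * b) * continuant (of_nat m) (x - a) (a + b) (- (a * b)) (Suc m)"
    unfolding continuant_shift[of "of_nat (Suc m)"] by (simp add: algebra_simps)
  also have "\<dots> = (x - of_nat (Suc m) * b) *
      (\<Prod>k\<le>m. (x - a) - of_nat k * a - of_nat (m - k) * b)"
    by (simp only: Suc.IH)
  also have "(\<Prod>k\<le>m. (x - a) - of_nat k * a - of_nat (m - k) * b) =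
      (\<Prod>k\<le>m. x - of_nat (Suc k) * a - of_nat (Suc m - Suc k) * b)"
    by (intro prod.cong) (auto simp: algebra_simps)
  finally show ?case
    unfolding prod.atMost_Suc_shift by simp
qed

text \<open>
  The composition of the shifts by \<open>a\<close> and \<open>b\<close>, where \<open>K = a + b\<close> and \<open>P = - a b\<close>. It is
  stated without \<open>a\<close> and \<open>b\<close>, which need not exist in the ring at hand.
\<close>

lemma continuant_shift2:
  fixes M x K P :: "'a::comm_ring_1"
  shows "continuant M x K P (Suc (Suc k)) =
    continuant (M - 2) (x - K) K P (Suc (Suc k))
    + of_nat (Suc (Suc k)) * K * continuant (M - 2) (x - K) K P (Suc k)
    - of_nat (Suc (Suc k)) * of_nat (Suc k) * P * continuant (M - 2) (x - K) K P k"
proof (induction k rule: induct_nat_012)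
  case 0
  then show ?case by (simp add: algebra_simps)
next
  case 1
  then show ?case by (simp add: algebra_simps)
next
  case (ge2 k)
  show ?case
    unfolding continuant.simps(3)[of M x _ _ "Suc (Suc k)"] ge2
    by (simp add: algebra_simps)
qed

text \<open>At \<open>M = m + 2\<close> the shifted continuants of orders \<open>m + 3\<close> and
  \<open>m + 2\<close> are multiples of the one of order \<open>m + 1\<close>, because the
  coefficient \<open>M - 2 - m\<close> vanishes. The quadratic factor collects the three terms of
  \<open>continuant_shift2\<close>.\<close>

lemma continuant_reduce:
  fixes x K P :: "'a::comm_ring_1"
  shows "continuant (of_nat (Suc (Suc m))) x K P (Suc (Suc (Suc m))) =
    (x * (x - of_nat (Suc (Suc m)) * K) - of_nat (Suc (Suc m)) ^ 2 * P) *
    continuant (of_nat m) (x - K) K P (Suc m)"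
proof -
  have M: "of_nat (Suc (Suc m)) - 2 = (of_nat m :: 'a)" by simp
  show ?thesis
    unfolding continuant_shift2[of "of_nat (Suc (Suc m))"] M
    by (simp add: algebra_simps power2_eq_square)
qed

section \<open>Column determinants of tridiagonal matrices\<close>

text \<open>The entries form a function on all pairs of naturals, so that minors of different orders
  belong to one fixed \<open>a\<close>.\<close>

definition leading_det :: "(nat \<Rightarrow> nat \<Rightarrow> 'a::ring_1) \<Rightarrow> nat \<Rightarrow> 'a" where
  "leading_det a n = (\<Sum>p | p permutes {0..<n}.
      of_int (sign p) * prod_list (map (\<lambda>j. a (p j) j) [0..<n]))"

lemma sign_comp_transpose:
  fixes p :: "nat \<Rightarrow> nat"
  assumes "p permutes {0..<n}" "i \<noteq> j"
  shows "sign (p \<circ> transpose i j) = - sign p"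
proof -
  have "permutation p" by (rule permutes_imp_permutation[OF _ assms(1)]) simp
  then show ?thesis using assms(2) by (simp add: sign_compose[OF _ permutation_swap_id] sign_swap_id)
qed

lemma prod_list_zero: "0 \<in> set xs \<Longrightarrow> prod_list xs = (0::'a::semiring_1)"
  by (induction xs) auto

text \<open>A permutation with nonvanishing product moves every index by at most 1. It therefore
  fixes the last index or exchanges the last two, and the corresponding entries are the rightmost
  factors, in column order.\<close>

lemma leading_det_tridiagonal:
  assumes z: "\<And>i j. Suc i < j \<or> Suc j < i \<Longrightarrow> a i j = 0"
  shows "leading_det a (Suc (Suc n)) =
    leading_det a (Suc n) * a (Suc n) (Suc n) - leading_det a n * (a (Suc n) n * a n (Suc n))"
proof -
  let ?t = "\<lambda>n p. of_int (sign p) * prod_list (map (\<lambda>j. a (p j) j) [0..<n])"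
  \<comment> \<open>\<open>?A\<close> consists of the permutations that fix \<open>Suc n\<close>,
    \<open>?B\<close> of those that exchange \<open>n\<close> and \<open>Suc n\<close>.\<close>
  let ?A = "{p. p permutes {0..<Suc n}}"
  let ?\<tau> = "transpose n (Suc n)"
  let ?B = "(\<lambda>p. p \<circ> ?\<tau>) ` {p. p permutes {0..<n}}"
  have fin: "finite {p. p permutes {0..<k}}" for k :: nat
    by (simp add: finite_permutations)
  have fixed: "p n = n" "p (Suc n) = Suc n" if "p permutes {0..<n}" for p
    using that by (auto simp: permutes_def)
  have fixed': "p (Suc n) = Suc n" if "p permutes {0..<Suc n}" for p
    using that by (auto simp: permutes_def)
  have tr: "?\<tau> permutes {0..<Suc (Suc n)}" by (intro permutes_swap_id) auto
  have sub: "?A \<union> ?B \<subseteq> {p. p permutes {0..<Suc (Suc n)}}"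
  proof -
    have "p permutes {0..<Suc (Suc n)}" if "p permutes {0..<k}" "k \<le> Suc n" for p k
      using that by (auto intro: permutes_subset)
    then show ?thesis using permutes_compose[OF tr] by (auto simp del: atLeastLessThan_iff)
  qed
  have disj: "?A \<inter> ?B = {}"
  proof (rule ccontr)
    assume "?A \<inter> ?B \<noteq> {}"
    then obtain q where q: "q permutes {0..<n}" and "q \<circ> ?\<tau> permutes {0..<Suc n}" by blast
    then have "(q \<circ> ?\<tau>) (Suc n) = Suc n" by (intro fixed')
    then show False using fixed(1)[OF q] by simp
  qed
  have inj: "inj_on (\<lambda>p. p \<circ> ?\<tau>) {p. p permutes {0..<n}}"
  proof (rule inj_onI)
    fix p q :: "nat \<Rightarrow> nat" assume "p \<circ> ?\<tau> = q \<circ> ?\<tau>"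
    then have "p \<circ> ?\<tau> \<circ> ?\<tau> = q \<circ> ?\<tau> \<circ> ?\<tau>" by simp
    then show "p = q" by (simp add: comp_assoc)
  qed
  have vanish: "?t (Suc (Suc n)) p = 0" if p: "p permutes {0..<Suc (Suc n)}" and nin: "p \<notin> ?A \<union> ?B" for p
  proof -
    have "\<exists>j<Suc (Suc n). a (p j) j = 0"
    proof (rule ccontr)
      assume "\<not> ?thesis"
      then have nz: "a (p j) j \<noteq> 0" if "j < Suc (Suc n)" for j using that by blast
      have near: "p j \<le> Suc j" "j \<le> Suc (p j)" if "j < Suc (Suc n)" for j
        using nz[OF that] z[of "p j" j] by linarith+
      show False
      proof (cases "p (Suc n) = Suc n")
        case True
        have "p permutes {0..<Suc n}"
        proof (rule permutes_superset[OF p])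
          fix x assume "x \<in> {0..<Suc (Suc n)} - {0..<Suc n}"
          then have "x = Suc n" by auto
          then show "p x = x" using True by simp
        qed
        then show False using nin by simp
      next
        case False
        have "p (Suc n) < Suc (Suc n)" using permutes_in_image[OF p, of "Suc n"] by simp
        then have pn: "p (Suc n) = n" using False near[of "Suc n"] by auto
        \<comment> \<open>Bandedness leaves only \<open>n\<close> and \<open>Suc n\<close> as
          preimages of \<open>Suc n\<close>, and \<open>Suc n\<close> goes to \<open>n\<close>; so
          \<open>p\<close> exchanges the two.\<close>
        obtain i where i: "p i = Suc n" using permutes_surj[OF p] by (metis surjD)
        have "i < Suc (Suc n)" using permutes_in_image[OF p, of i] i by simp
        moreover have "i \<noteq> Suc n" using i pn by auto
        ultimately have "i = n" using near[of i] i by auto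
        with i have pn': "p n = Suc n" by simp
        have q: "p \<circ> ?\<tau> permutes {0..<Suc (Suc n)}" using permutes_compose[OF tr p] .
        have "p \<circ> ?\<tau> permutes {0..<n}"
        proof (rule permutes_superset[OF q])
          fix x assume "x \<in> {0..<Suc (Suc n)} - {0..<n}"
          then have "x = n \<or> x = Suc n" by auto
          then show "(p \<circ> ?\<tau>) x = x" using pn pn' by auto
        qed
        moreover have "p = (p \<circ> ?\<tau>) \<circ> ?\<tau>" by (simp add: comp_assoc)
        ultimately show False using nin by blast
      qed
    qed
    then have "0 \<in> set (map (\<lambda>j. a (p j) j) [0..<Suc (Suc n)])" by (force simp del: upt_Suc)
    then show ?thesis using prod_list_zero by (metis mult_zero_right)
  qed
  have 1: "(\<Sum>p\<in>?A. ?t (Suc (Suc n)) p) = leading_det a (Suc n) * a (Suc n) (Suc n)"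
    unfolding leading_det_def sum_distrib_right
    by (intro sum.cong refl) (simp add: fixed' mult.assoc)
  have "(\<Sum>p\<in>?B. ?t (Suc (Suc n)) p) = (\<Sum>p | p permutes {0..<n}. ?t (Suc (Suc n)) (p \<circ> ?\<tau>))"
    by (subst sum.reindex[OF inj]) simp
  also have "\<dots> = (\<Sum>p | p permutes {0..<n}. - (?t n p * (a (Suc n) n * a n (Suc n))))"
  proof (intro sum.cong refl)
    fix p assume "p \<in> {p. p permutes {0..<n}}"
    then have p: "p permutes {0..<n}" by simp
    have eq: "map (\<lambda>j. a (p (?\<tau> j)) j) [0..<n] = map (\<lambda>j. a (p j) j) [0..<n]"
      by (simp add: transpose_def)
    then show "?t (Suc (Suc n)) (p \<circ> ?\<tau>) = - (?t n p * (a (Suc n) n * a n (Suc n)))"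
      using p by (simp add: fixed[OF p] sign_comp_transpose mult.assoc eq)
  qed
  also have "\<dots> = - (leading_det a n * (a (Suc n) n * a n (Suc n)))"
    by (simp add: leading_det_def sum_distrib_right sum_negf)
  finally have 2: "(\<Sum>p\<in>?B. ?t (Suc (Suc n)) p) = - (leading_det a n * (a (Suc n) n * a n (Suc n)))" .
  have "leading_det a (Suc (Suc n)) = (\<Sum>p\<in>?A \<union> ?B. ?t (Suc (Suc n)) p)"
    unfolding leading_det_def
    by (rule sum.mono_neutral_right) (use fin sub vanish in auto)
  also have "\<dots> = (\<Sum>p\<in>?A. ?t (Suc (Suc n)) p) + (\<Sum>p\<in>?B. ?t (Suc (Suc n)) p)"
    by (rule sum.union_disjoint) (use fin disj in auto)
  finally show ?thesis unfolding 1 2 by simp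
qed

text \<open>Off-diagonal entries enter the expansion only through products of opposite pairs, so it
  becomes the recursion that defines the continuant.\<close>

lemma leading_det_eq_continuant:
  assumes "\<And>i j. Suc i < j \<or> Suc j < i \<Longrightarrow> a i j = 0"
    and "\<And>j. j < n \<Longrightarrow> a j j = x - of_nat j * K"
    and "\<And>j. Suc j < n \<Longrightarrow> a (Suc j) j * a j (Suc j) = of_nat (Suc j) * (M - of_nat j) * P"
  shows "leading_det a n = continuant M x K P n"
  using assms(2,3)
proof (induction n rule: induct_nat_012)
  case 0
  then show ?case by (simp add: leading_det_def sign_id)
next
  case 1
  then show ?case by (simp add: leading_det_def sign_id)
next
  case (ge2 n)
  show ?case
    using ge2 by (simp add: leading_det_tridiagonal[OF assms(1)])
qed

section \<open>Commutation relations and generators of the enveloping algebra\<close>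

text \<open>A finitely supported function is a finite sum of single terms, so additive identities
  need only be checked on monomials.\<close>

lemma poly_mapping_induct_single [case_names single add]:
  fixes p :: "'a \<Rightarrow>\<^sub>0 'b::comm_monoid_add"
  assumes single: "\<And>k c. P (Poly_Mapping.single k c)"
    and add: "\<And>p q. P p \<Longrightarrow> P q \<Longrightarrow> P (p + q)"
  shows "P p"
proof -
  have "p = (\<Sum>k\<in>Poly_Mapping.keys p. Poly_Mapping.single k (Poly_Mapping.lookup p k))"
    by (rule poly_mapping_eqI) (simp add: lookup_sum lookup_single when_def in_keys_iff)
  moreover have "P (\<Sum>k\<in>A. Poly_Mapping.single k (Poly_Mapping.lookup p k))" if "finite A" for A
    using that
  proof induction
    case empty
    \<comment> \<open>Zero is a single term with coefficient 0, whatever its index.\<close>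
    show ?case using single[of undefined 0] by simp
  qed (simp add: single add)
  ultimately show ?thesis by (metis finite_keys)
qed

lemma ug_rel_relator: "p - q \<in> ug_relators \<Longrightarrow> ug_rel p q"
  unfolding ug_rel_def using two_sided_ideal.gen[of "p - q" ug_relators 1 1] by simp

lemma ug_incl_add: "ug_incl (x + y) = ug_incl x + ug_incl y"
  by transfer (rule ug_rel_relator, auto simp: ug_relators_def diff_diff_eq)

lemma ug_incl_scale: "ug_incl (\<chi> i j. c * x $ i $ j) = uscale c (ug_incl x)"
  by transfer (rule ug_rel_relator, auto simp: ug_relators_def)

lemma ug_incl_bracket: "ug_incl x * ug_incl y - ug_incl y * ug_incl x = ug_incl (x ** y - y ** x)"
  by transfer (rule ug_rel_relator, auto simp: ug_relators_def)

lemma ug_incl_zero: "ug_incl 0 = 0"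
  using ug_incl_add[of 0 0] by simp

lemma ug_incl_diff: "ug_incl (x - y) = ug_incl x - ug_incl y"
  using ug_incl_add[of "x - y" y] by (simp add: algebra_simps)

lemma ug_rel_refl: "p = q \<Longrightarrow> ug_rel p q"
  using equivp_ug_rel by (simp add: equivp_reflp)

text \<open>Reduces scaling to multiplication by a ring element, which is central by
  \<open>uscale_1_central\<close>.\<close>

lemma uscale_eq: "uscale c z = uscale c 1 * z"
  by transfer (simp add: ug_rel_refl)

lemma uscale_1: "uscale 1 z = z"
  by transfer (rule ug_rel_refl, metis mult_1 single_one)

lemma uscale_0: "uscale 0 z = 0"
  by transfer (simp add: ug_rel_refl)

lemma uscale_add_left: "uscale (c + d) z = uscale c z + uscale d z"
  by transfer (simp add: ug_rel_refl single_add distrib_right)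

lemma uscale_uscale: "uscale c (uscale d z) = uscale (c * d) z"
  by transfer (simp add: ug_rel_refl mult_single mult.assoc[symmetric])

lemma uscale_of_nat: "uscale (of_nat n) 1 = of_nat n"
  by (induction n) (simp_all add: uscale_0 uscale_1 uscale_add_left)

lemma single_0_commute:
  "Poly_Mapping.single 0 (c::complex) * (p :: free_gl2) = p * Poly_Mapping.single 0 c"
proof (induction p rule: poly_mapping_induct_single)
  case (single k d)
  then show ?case by (simp add: mult_single mult.commute)
qed (simp add: algebra_simps)

lemma uscale_1_central: "uscale c 1 * z = z * uscale c 1"
  by transfer (simp add: ug_rel_refl single_0_commute)

abbreviation entry :: "gl2 \<Rightarrow> 2 \<Rightarrow> 2 \<Rightarrow> complex" where
  "entry x i j \<equiv> x $ i $ j"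

lemma ug_incl_eq_sum_E:
  "ug_incl x = uscale (entry x 1 1) (E 1 1) + uscale (entry x 1 2) (E 1 2)
    + uscale (entry x 2 1) (E 2 1) + uscale (entry x 2 2) (E 2 2)"
proof -
  let ?u = "\<lambda>i j. \<chi> k l. entry x i j * entry (axis i (axis j 1)) k l"
  have "x = ?u 1 1 + ?u 1 2 + ?u 2 1 + ?u 2 2"
  proof -
    have "entry x i j = entry (?u 1 1 + ?u 1 2 + ?u 2 1 + ?u 2 2) i j" for i j
      using exhaust_2[of i] exhaust_2[of j] by (elim disjE) (simp_all add: axis_def)
    then show ?thesis unfolding Finite_Cartesian_Product.vec_eq_iff by blast
  qed
  then have "ug_incl x = ug_incl (?u 1 1 + ?u 1 2 + ?u 2 1 + ?u 2 2)" by (rule arg_cong)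
  then show ?thesis
    unfolding ug_incl_add ug_incl_scale E_def .
qed

lemma axis_mult_axis:
  fixes i j k l :: 2
  shows "axis i (axis j 1) ** axis k (axis l 1) = (if j = k then axis i (axis l 1) else (0::gl2))"
proof -
  have "entry (axis i (axis j 1) ** axis k (axis l 1)) a b =
      entry (if j = k then axis i (axis l 1) else 0) a b" for a b
    unfolding matrix_matrix_mult_def sum_2
    using exhaust_2[of j] exhaust_2[of k] by (elim disjE) (simp_all add: axis_def)
  then show ?thesis unfolding Finite_Cartesian_Product.vec_eq_iff by blast
qed

lemma E_bracket:
  "E i j * E k l - E k l * E i j = (if j = k then E i l else 0) - (if l = i then E k j else 0)"
  unfolding E_def ug_incl_bracket axis_mult_axis ug_incl_diff by (auto simp: ug_incl_zero)

text \<open>Elements of the quotient are classes of linear combinations of words, words are products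
  of elements of \<open>gl2\<close>, and these are combinations of matrix units. Centrality need
  then only be checked on the matrix units.\<close>

lemma ugl2_induct [case_names scalar E add mult]:
  assumes scalar: "\<And>c. P (uscale c 1)"
    and E: "\<And>i j. P (E i j)"
    and add: "\<And>x y. P x \<Longrightarrow> P y \<Longrightarrow> P (x + y)"
    and mult: "\<And>x y. P x \<Longrightarrow> P y \<Longrightarrow> P (x * y)"
  shows "P z"
proof -
  have uscale: "P (uscale c x)" if "P x" for c x
    using mult[OF scalar that] uscale_eq by metis
  have incl: "P (ug_incl x)" for x
    unfolding ug_incl_eq_sum_E by (intro add uscale E)
  have word: "P (abs_ugl2 (Poly_Mapping.single (Word xs) 1))" for xs
  proof (induction xs)
    case Nil
    have "abs_ugl2 (Poly_Mapping.single (Word []) 1) = uscale 1 1"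
      unfolding uscale_1 by (metis one_ugl2.abs_eq single_one zero_free_word_def)
    then show ?case using scalar by simp
  next
    case (Cons x xs)
    have "Poly_Mapping.single (Word (x # xs)) 1 = free_gen x * Poly_Mapping.single (Word xs) 1"
      by (simp add: free_gen_def mult_single plus_free_word_def)
    then have "abs_ugl2 (Poly_Mapping.single (Word (x # xs)) 1) =
        ug_incl x * abs_ugl2 (Poly_Mapping.single (Word xs) 1)"
      by (simp add: times_ugl2.abs_eq ug_incl.abs_eq)
    then show ?case using mult incl Cons by simp
  qed
  have "P (abs_ugl2 p)" for p
  proof (induction p rule: poly_mapping_induct_single)
    case (single w c)
    have "Poly_Mapping.single w c = Poly_Mapping.single 0 c * Poly_Mapping.single w 1"
      by (simp add: mult_single)
    then have "abs_ugl2 (Poly_Mapping.single w c) = uscale c (abs_ugl2 (Poly_Mapping.single w 1))"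
      by (simp add: uscale.abs_eq)
    then show ?case using uscale word by (metis free_word.exhaust)
  next
    case (add p q)
    then show ?case using assms(3) by (metis plus_ugl2.abs_eq)
  qed
  then show ?thesis by (rule ugl2.abs_induct)
qed

lemma ug_centerI:
  assumes "\<And>i j. z * E i j = E i j * z"
  shows "z \<in> ug_center"
proof -
  have "z * x = x * z" for x
  proof (induction x rule: ugl2_induct)
    case (mult x y)
    then show ?case by (metis mult.assoc)
  qed (simp_all add: uscale_1_central assms algebra_simps)
  then show ?thesis by (simp add: ug_center_def)
qed

section \<open>Commutation relations and two central elements\<close>

lemma E_commutation:
  "E 1 1 * E 1 2 = E 1 2 * E 1 1 + E 1 2"
  "E 2 2 * E 1 2 = E 1 2 * E 2 2 - E 1 2"
  "E 1 1 * E 2 1 = E 2 1 * E 1 1 - E 2 1"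
  "E 2 2 * E 2 1 = E 2 1 * E 2 2 + E 2 1"
  "E 1 1 * E 2 2 = E 2 2 * E 1 1"
  "E 1 2 * E 2 1 = E 2 1 * E 1 2 + E 1 1 - E 2 2"
  using E_bracket[of 1 1 1 2] E_bracket[of 2 2 1 2] E_bracket[of 1 1 2 1] E_bracket[of 2 2 2 1]
    E_bracket[of 1 1 2 2] E_bracket[of 1 2 2 1]
  by (simp_all add: algebra_simps)

text \<open>The weights of \<open>E 1 2\<close> and \<open>E 2 1\<close> under the diagonal matrix
  units are opposite and cancel in the product.\<close>

lemma E_commute_E12_E21: "E i i * (E 1 2 * E 2 1) = E 1 2 * E 2 1 * E i i"
proof -
  have "E 1 1 * (E 1 2 * E 2 1) = E 1 2 * E 2 1 * E 1 1"
    by (metis (no_types, lifting) E_commutation(1,3) add_diff_cancel_right' distrib_right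
        mult.assoc right_diff_distrib diff_add_cancel)
  moreover
  have "E 2 2 * (E 1 2 * E 2 1) = E 1 2 * E 2 1 * E 2 2"
    unfolding mult.assoc[symmetric] E_commutation(2) left_diff_distrib
    by (simp add: mult.assoc E_commutation(4) distrib_left)
  ultimately show ?thesis
    using exhaust_2[of i] by (elim disjE) (simp_all only:)
qed

text \<open>This is the image of the identity matrix, which commutes with all of
  \<open>gl2\<close>.\<close>

lemma trace_central: "E 1 1 + E 2 2 \<in> ug_center"
proof (rule ug_centerI)
  fix i j :: 2
  show "(E 1 1 + E 2 2) * E i j = E i j * (E 1 1 + E 2 2)"
    using E_bracket[of 1 1 i j] E_bracket[of 2 2 i j] exhaust_2[of i] exhaust_2[of j]
    by (auto simp: algebra_simps)
qed

text \<open>The element equals \<open>2 * (e * f + f * e) + h * h + 1\<close>, an affine function of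
  the Casimir element of an sl2 triple.\<close>

lemma sl2_casimir_commute:
  fixes e f h :: "'a::ring_1"
  assumes he: "h * e = e * h + e + e" and hf: "h * f = f * h - f - f" and ef: "e * f = f * e + h"
  shows "((h - 1)\<^sup>2 + 4 * (e * f)) * e = e * ((h - 1)\<^sup>2 + 4 * (e * f))"
    and "((h - 1)\<^sup>2 + 4 * (e * f)) * f = f * ((h - 1)\<^sup>2 + 4 * (e * f))"
proof -
  \<comment> \<open>The relations with a further right factor \<open>z\<close> reach inside
    right-nested products, so that every product can be sorted into the order \<open>f\<close>,
    \<open>e\<close>, \<open>h\<close>.\<close>
  have he': "h * (e * z) = e * (h * z) + e * z + e * z"
    and hf': "h * (f * z) = f * (h * z) - f * z - f * z"
    and ef': "e * (f * z) = f * (e * z) + h * z" for z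
    using he hf ef by (metis mult.assoc distrib_right left_diff_distrib)+
  have four: "4 * z = z + z + z + z" for z :: 'a
  proof -
    have "(4::'a) = 1 + 1 + 1 + 1" by simp
    then show ?thesis by (simp only: distrib_right mult_1_left)
  qed
  show "((h - 1)\<^sup>2 + 4 * (e * f)) * e = e * ((h - 1)\<^sup>2 + 4 * (e * f))"
    by (simp add: power2_eq_square four he he' hf hf' ef ef' algebra_simps)
  show "((h - 1)\<^sup>2 + 4 * (e * f)) * f = f * ((h - 1)\<^sup>2 + 4 * (e * f))"
    by (simp add: power2_eq_square four he he' hf hf' ef ef' algebra_simps)
qed

text \<open>With \<open>h = E 1 1 - E 2 2\<close> this is the sl2 element above, which settles
  \<open>E 1 2\<close> and \<open>E 2 1\<close>. With the diagonal matrix units each summand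
  commutes separately.\<close>

lemma casimir_central: "(E 1 1 - E 2 2 - 1)\<^sup>2 + 4 * (E 1 2 * E 2 1) \<in> ug_center" (is "?C \<in> _")
proof (rule ug_centerI)
  define H where "H = E 1 1 - E 2 2"
  have HE: "H * E 1 2 = E 1 2 * H + E 1 2 + E 1 2"
    and HF: "H * E 2 1 = E 2 1 * H - E 2 1 - E 2 1"
    and EF: "E 1 2 * E 2 1 = E 2 1 * E 1 2 + H"
    unfolding H_def left_diff_distrib right_diff_distrib E_commutation by simp_all
  have off: "?C * E 1 2 = E 1 2 * ?C" "?C * E 2 1 = E 2 1 * ?C"
    using sl2_casimir_commute[OF HE HF EF] by (simp_all add: H_def)
  have diag: "?C * E i i = E i i * ?C" for i
  proof -
    have "(H - 1) * E i i = E i i * (H - 1)"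
      using exhaust_2[of i] E_commutation(5) by (auto simp: H_def algebra_simps)
    then have "(H - 1)\<^sup>2 * E i i = E i i * (H - 1)\<^sup>2"
      unfolding power2_eq_square by (metis mult.assoc)
    moreover have "4 * (E 1 2 * E 2 1) * E i i = E i i * (4 * (E 1 2 * E 2 1))"
      by (metis E_commute_E12_E21 mult.assoc mult_of_nat_commute of_nat_numeral)
    ultimately show ?thesis by (simp add: distrib_left distrib_right H_def)
  qed
  show "?C * E i j = E i j * ?C" for i j
    using exhaust_2[of i] exhaust_2[of j] off diag by (elim disjE) (simp_all only:)
qed

section \<open>Centrality of the shifted determinant\<close>

text \<open>Completing the square in \<open>x\<close>. Four is kept as two factors 2, to be removed
  by halving twice.\<close>

lemma quadruple_reduction_factor:
  fixes x K P n :: "'a::comm_ring_1"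
  shows "2 * (2 * (x * (x - n * K) - n\<^sup>2 * P)) =
    (2 * x - n * K) * (2 * x - n * K) - n * n * (K\<^sup>2 + 4 * P)"
proof -
  have "(2::'a) = 1 + 1" "(4::'a) = 1 + 1 + 1 + 1" by simp_all
  then show ?thesis
    by (simp only: algebra_simps power2_eq_square mult_1_left mult_1_right)
qed

text \<open>Induction in steps of two through \<open>continuant_reduce\<close>: four times the
  quadratic factor is a polynomial in the two given members of \<open>Z\<close>. The starting cases
  are \<open>x\<close> and \<open>x * (x - K) - P\<close>.\<close>

lemma continuant_in_subring:
  fixes Z :: "'a::comm_ring_1 set"
  assumes diff: "\<And>y z. y \<in> Z \<Longrightarrow> z \<in> Z \<Longrightarrow> y - z \<in> Z"
    and mult: "\<And>y z. y \<in> Z \<Longrightarrow> z \<in> Z \<Longrightarrow> y * z \<in> Z"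
    and half: "\<And>y. 2 * y \<in> Z \<Longrightarrow> y \<in> Z"
    and nat: "\<And>k. of_nat k \<in> Z"
    and Q: "K\<^sup>2 + 4 * P \<in> Z"
    and w: "2 * x - of_nat m * K \<in> Z"
  shows "continuant (of_nat m) x K P (Suc m) \<in> Z"
  using w
proof (induction m arbitrary: x rule: induct_nat_012)
  case 0
  then have "2 * x \<in> Z" by simp
  then show ?case using half[of x] by simp
next
  case 1
  have "2 * (2 * (x * (x - K) - P)) =
      (2 * x - of_nat 1 * K) * (2 * x - of_nat 1 * K) - of_nat 1 * of_nat 1 * (K\<^sup>2 + 4 * P)"
    using quadruple_reduction_factor[of x 1 K P] by (simp only: of_nat_1 mult_1 one_power2)
  also have "\<dots> \<in> Z" by (intro diff mult 1[unfolded One_nat_def[symmetric]] nat Q)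
  finally have "x * (x - K) - P \<in> Z" by (rule half[OF half])
  then show ?case by simp
next
  case (ge2 m)
  let ?n = "of_nat (Suc (Suc m)) :: 'a"
  have "2 * (2 * (x * (x - ?n * K) - ?n ^ 2 * P)) = (2 * x - ?n * K) * (2 * x - ?n * K) - ?n * ?n * (K\<^sup>2 + 4 * P)"
    by (rule quadruple_reduction_factor)
  also have "\<dots> \<in> Z" by (intro diff mult ge2.prems nat Q)
  finally have "x * (x - ?n * K) - ?n ^ 2 * P \<in> Z" by (rule half[OF half])
  moreover have "continuant (of_nat m) (x - K) K P (Suc m) \<in> Z"
  proof (rule ge2.IH(1))
    \<comment> \<open>This combination does not change when \<open>(x, m + 2)\<close> becomes
      \<open>(x - K, m)\<close>.\<close>
    have eq: "2 * (x - K) - of_nat m * K = 2 * x - ?n * K"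
      by (simp add: algebra_simps)
    show "2 * (x - K) - of_nat m * K \<in> Z" unfolding eq by (rule ge2.prems)
  qed
  ultimately show ?case unfolding continuant_reduce by (intro mult)
qed

section \<open>Commutants and polynomials in u\<close>

definition centralizer :: "'a::ring_1 set \<Rightarrow> 'a set" where
  "centralizer S = {x. \<forall>s\<in>S. x * s = s * x}"

lemma centralizerD: "x \<in> centralizer S \<Longrightarrow> s \<in> S \<Longrightarrow> x * s = s * x"
  and centralizerI: "(\<And>s. s \<in> S \<Longrightarrow> x * s = s * x) \<Longrightarrow> x \<in> centralizer S"
  unfolding centralizer_def by blast+

lemma centralizer_0: "0 \<in> centralizer S"
  and centralizer_1: "1 \<in> centralizer S"
  and centralizer_add: "x \<in> centralizer S \<Longrightarrow> y \<in> centralizer S \<Longrightarrow> x + y \<in> centralizer S"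
  and centralizer_diff: "x \<in> centralizer S \<Longrightarrow> y \<in> centralizer S \<Longrightarrow> x - y \<in> centralizer S"
  and centralizer_uminus: "x \<in> centralizer S \<Longrightarrow> - x \<in> centralizer S"
  by (auto simp: centralizer_def distrib_left distrib_right left_diff_distrib right_diff_distrib)

lemma centralizer_mult: "x \<in> centralizer S \<Longrightarrow> y \<in> centralizer S \<Longrightarrow> x * y \<in> centralizer S"
  by (rule centralizerI) (metis centralizerD mult.assoc)

lemma centralizer_of_nat: "of_nat k \<in> centralizer S"
  by (simp add: centralizer_def mult_of_nat_commute)

lemma centralizer_antimono: "S \<subseteq> T \<Longrightarrow> centralizer T \<subseteq> centralizer S"
  by (auto simp: centralizer_def)

text \<open>As the elements of \<open>S\<close> commute, the bicommutant lies in the commutant. This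
  makes the bicommutant a commutative ring without a description of its elements.\<close>

lemma bicommutant_commute:
  assumes S: "S \<subseteq> centralizer S" and x: "x \<in> centralizer (centralizer S)"
    and y: "y \<in> centralizer (centralizer S)"
  shows "x * y = y * x"
proof -
  have "y \<in> centralizer S" using centralizer_antimono[OF S] y by blast
  then show ?thesis by (rule centralizerD[OF x])
qed

lemma subset_bicommutant: "S \<subseteq> centralizer (centralizer S)"
  by (auto simp: centralizer_def)

lemma upoly_const_simps:
  "upoly_const 0 = 0" "upoly_const 1 = 1"
  "upoly_const (a + b) = upoly_const a + upoly_const b"
  "upoly_const (a - b) = upoly_const a - upoly_const b"
  "upoly_const (a * b) = upoly_const a * upoly_const b"
  "upoly_const (of_nat k) = of_nat k"
  "upoly_const (numeral w) = numeral w"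
  by (simp_all add: upoly_const_def single_add single_diff mult_single)

lemma lookup_mult_upoly_const:
  "Poly_Mapping.lookup (p * upoly_const y) n = Poly_Mapping.lookup p n * y"
  "Poly_Mapping.lookup (upoly_const y * p) n = y * Poly_Mapping.lookup p n"
  by (induction p rule: poly_mapping_induct_single)
     (auto simp: upoly_const_def mult_single lookup_single when_def distrib_left distrib_right lookup_add)

lemma lookup_mult_upoly_var:
  "Poly_Mapping.lookup (p * upoly_var) n = (case n of 0 \<Rightarrow> 0 | Suc k \<Rightarrow> Poly_Mapping.lookup p k)"
  by (induction p rule: poly_mapping_induct_single)
     (auto simp: upoly_var_def mult_single lookup_single when_def distrib_right lookup_add split: nat.split)

text \<open>It suffices to commute with constants, since multiplication by them acts coefficient by
  coefficient.\<close>

lemma lookup_in_ug_center: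
  fixes p :: "nat \<Rightarrow>\<^sub>0 ugl2"
  assumes "p \<in> centralizer UNIV"
  shows "Poly_Mapping.lookup p n \<in> ug_center"
proof -
  have "Poly_Mapping.lookup p n * y = y * Poly_Mapping.lookup p n" for y
    using arg_cong[OF centralizerD[OF assms, of "upoly_const y"], of "\<lambda>q. Poly_Mapping.lookup q n"]
    by (simp only: lookup_mult_upoly_const UNIV_I)
  then show ?thesis unfolding ug_center_def by blast
qed

lemma upoly_const_central:
  assumes "z \<in> ug_center"
  shows "upoly_const z \<in> centralizer UNIV"
proof (rule centralizerI)
  fix q :: "nat \<Rightarrow>\<^sub>0 ugl2"
  have "z * y = y * z" for y using assms unfolding ug_center_def by blast
  then show "upoly_const z * q = q * upoly_const z"
    by (intro poly_mapping_eqI) (simp only: lookup_mult_upoly_const)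
qed

lemma upoly_var_central: "upoly_var \<in> centralizer UNIV"
proof (rule centralizerI)
  fix q :: "nat \<Rightarrow>\<^sub>0 ugl2"
  show "upoly_var * q = q * upoly_var"
    by (induction q rule: poly_mapping_induct_single)
       (simp_all only: upoly_var_def mult_single distrib_left distrib_right add.commute mult_1_left mult_1_right)
qed

lemma uscale_in_ug_center: "uscale c 1 \<in> ug_center"
  by (simp add: ug_center_def uscale_1_central)

text \<open>These generate the weight zero subalgebra of the enveloping algebra. The variable
  \<open>u\<close> is central and so enters the bicommutant anyway.\<close>

definition weight_zero_gens :: "(nat \<Rightarrow>\<^sub>0 ugl2) set" where
  "weight_zero_gens = upoly_const ` {E 1 1, E 2 2, E 1 2 * E 2 1}"

lemma weight_zero_gens_commute: "weight_zero_gens \<subseteq> centralizer weight_zero_gens"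
proof -
  have "a * b = b * a" if "a \<in> {E 1 1, E 2 2, E 1 2 * E 2 1}" "b \<in> {E 1 1, E 2 2, E 1 2 * E 2 1}" for a b
    using that by (elim insertE emptyE) (simp_all only: E_commute_E12_E21 E_commutation(5))
  then show ?thesis
    unfolding weight_zero_gens_def
    by (intro subsetI centralizerI) (elim imageE, simp only: upoly_const_simps(5)[symmetric])
qed

text \<open>
  The entries of the braided Casimir do not commute, but its column determinant only involves
  elements of the following commutative subalgebra.
\<close>

typedef weight_zero = "centralizer (centralizer weight_zero_gens)"
  using centralizer_0 by blast

setup_lifting type_definition_weight_zero

instantiation weight_zero :: comm_ring_1
begin

lift_definition zero_weight_zero :: weight_zero is 0 by (rule centralizer_0)
lift_definition one_weight_zero :: weight_zero is 1 by (rule centralizer_1)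
lift_definition plus_weight_zero :: "weight_zero \<Rightarrow> weight_zero \<Rightarrow> weight_zero" is "(+)"
  by (rule centralizer_add)
lift_definition minus_weight_zero :: "weight_zero \<Rightarrow> weight_zero \<Rightarrow> weight_zero" is "(-)"
  by (rule centralizer_diff)
lift_definition uminus_weight_zero :: "weight_zero \<Rightarrow> weight_zero" is uminus
  by (rule centralizer_uminus)
lift_definition times_weight_zero :: "weight_zero \<Rightarrow> weight_zero \<Rightarrow> weight_zero" is "(*)"
  by (rule centralizer_mult)

instance
proof
  fix a b c :: weight_zero
  show "a * b = b * a"
    by transfer (rule bicommutant_commute[OF weight_zero_gens_commute])
  show "a + b = b + a" by transfer (rule add.commute)
  show "a + b + c = a + (b + c)" by transfer (rule add.assoc)
  show "a * b * c = a * (b * c)" by transfer (rule mult.assoc)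
  show "(a + b) * c = a * c + b * c" by transfer (rule distrib_right)
qed (transfer; simp)+

end

lemma Rep_of_nat: "Rep_weight_zero (of_nat k) = of_nat k"
  by (induction k) (simp_all add: zero_weight_zero.rep_eq one_weight_zero.rep_eq plus_weight_zero.rep_eq)

text \<open>The inclusion of the commutative ring respects the recursion, so identities of
  commutative algebra carry over to polynomials over the enveloping algebra.\<close>

lemma Rep_continuant:
  "Rep_weight_zero (continuant M x K P k) =
    continuant (Rep_weight_zero M) (Rep_weight_zero x) (Rep_weight_zero K) (Rep_weight_zero P) k"
  by (induction k rule: induct_nat_012)
     (simp_all only: continuant.simps one_weight_zero.rep_eq times_weight_zero.rep_eq
       minus_weight_zero.rep_eq Rep_of_nat)

lemma central_imp_weight_zero:
  "p \<in> centralizer UNIV \<Longrightarrow> p \<in> centralizer (centralizer weight_zero_gens)"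
  using centralizer_antimono[of "centralizer weight_zero_gens" UNIV] by blast

section \<open>The shifted determinant as a continuant\<close>

text \<open>The first diagonal entry of the shifted matrix. From there the diagonal decreases by
  \<open>casimir_K\<close> in each step, whose \<open>- 1\<close> comes from the shift
  \<open>L\<close>.\<close>

definition casimir_x :: "complex \<Rightarrow> complex \<Rightarrow> nat \<Rightarrow> nat \<Rightarrow>\<^sub>0 ugl2" where
  "casimir_x l1 l2 m = upoly_const (uscale l1 (E 1 1) + uscale l2 (E 2 2)) + upoly_var - of_nat m"

definition casimir_K :: "nat \<Rightarrow>\<^sub>0 ugl2" where
  "casimir_K = upoly_const (E 1 1 - E 2 2 - 1)"

definition casimir_P :: "nat \<Rightarrow>\<^sub>0 ugl2" where
  "casimir_P = upoly_const (E 1 2 * E 2 1)"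

lemma col_det_mat:
  "col_det (Matrix.mat n n (\<lambda>(i, j). a i j)) = leading_det a n"
  unfolding col_det_def leading_det_def
proof (intro sum.cong)
  fix p assume "p \<in> {p. p permutes {0..<n}}"
  then have "p j < n" if "j < n" for j using permutes_in_image[of p "{0..<n}" j] that by simp
  then have "map (\<lambda>j. Matrix.mat n n (\<lambda>(i, j). a i j) $$ (p j, j)) [0..<n] = map (\<lambda>j. a (p j) j) [0..<n]"
    by simp
  then show "of_int (sign p) * prod_list (map (\<lambda>j. Matrix.mat n n (\<lambda>(i, j). a i j) $$ (p j, j))
      [0..<dim_col (Matrix.mat n n (\<lambda>(i, j). a i j))]) =
    of_int (sign p) * prod_list (map (\<lambda>j. a (p j) j) [0..<n])" by (simp only: dim_col_mat)
qed simp

lemma uscale_diff_left: "uscale (c - d) z = uscale c z - uscale d z"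
  using uscale_add_left[of "c - d" d z] by (simp add: algebra_simps)

lemma uscale_of_nat_left: "uscale (of_nat k) z = of_nat k * z"
  using uscale_eq uscale_of_nat by metis

text \<open>Within a product the entry of column \<open>j\<close> stands left of that of column
  \<open>j + 1\<close>, so each opposite pair gives a multiple of \<open>E 1 2 * E 2 1\<close> and
  not of \<open>E 2 1 * E 1 2\<close>.\<close>

lemma shifted_det_eq_continuant:
  "shifted_det l1 l2 m = continuant (of_nat m) (casimir_x l1 l2 m) casimir_K casimir_P (Suc m)"
proof -
  define a where "a i j =
    (if i = j then upoly_const (uscale (l1 - of_nat i) (E 1 1) + uscale (l2 + of_nat i) (E 2 2))
        + upoly_var - of_nat (m - i)
     else if j = i + 1 then upoly_const (uscale (of_nat (m - i)) (E 2 1))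
     else if i = j + 1 then upoly_const (uscale (of_nat (j + 1)) (E 1 2)) else 0)" for i j
  have "braided_casimir_u l1 l2 m - shift_L m = Matrix.mat (Suc m) (Suc m) (\<lambda>(i, j). a i j)"
    by (rule eq_matI)
       (auto simp: a_def braided_casimir_u_def braided_casimir_def shift_L_def upoly_const_simps)
  then have "shifted_det l1 l2 m = leading_det a (Suc m)"
    unfolding shifted_det_def by (simp only: col_det_mat)
  also have "\<dots> = continuant (of_nat m) (casimir_x l1 l2 m) casimir_K casimir_P (Suc m)"
  proof (rule leading_det_eq_continuant)
    show "a i j = 0" if "Suc i < j \<or> Suc j < i" for i j using that by (auto simp: a_def)
    \<comment> \<open>For \<open>j \<le> m\<close> the truncated difference \<open>m - j\<close> is
      a true one.\<close>
    show "a j j = casimir_x l1 l2 m - of_nat j * casimir_K" if "j < Suc m" for j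
      using that
      by (simp add: a_def casimir_x_def casimir_K_def uscale_diff_left uscale_add_left
          uscale_of_nat_left upoly_const_simps algebra_simps of_nat_diff)
    show "a (Suc j) j * a j (Suc j) = of_nat (Suc j) * (of_nat m - of_nat j) * casimir_P"
      if "Suc j < Suc m" for j
    proof -
      have "a (Suc j) j * a j (Suc j) = upoly_const (of_nat (Suc j) * E 1 2 * (of_nat (m - j) * E 2 1))"
        by (simp add: a_def upoly_const_simps uscale_of_nat_left del: of_nat_Suc)
      also have "of_nat (Suc j) * E 1 2 * (of_nat (m - j) * E 2 1) =
          of_nat (Suc j) * of_nat (m - j) * (E 1 2 * E 2 1)"
        by (metis mult.assoc mult_of_nat_commute)
      also have "upoly_const \<dots> = of_nat (Suc j) * of_nat (m - j) * casimir_P"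
        by (simp add: upoly_const_simps casimir_P_def del: of_nat_Suc)
      finally show ?thesis using that by (simp add: of_nat_diff)
    qed
  qed
  finally show ?thesis .
qed

lemma upoly_const_uscale_central: "upoly_const (uscale c 1) \<in> centralizer UNIV"
  by (intro upoly_const_central uscale_in_ug_center)

text \<open>One half is a central scalar, and multiplying \<open>2 * y\<close> by it gives back
  \<open>y\<close>.\<close>

lemma half_central:
  fixes y :: "nat \<Rightarrow>\<^sub>0 ugl2"
  assumes "2 * y \<in> centralizer UNIV"
  shows "y \<in> centralizer UNIV"
proof -
  have "uscale (1/2) 1 * uscale 2 1 = uscale (1/2 * 2) 1"
    unfolding uscale_uscale[symmetric] by (rule uscale_eq[symmetric])
  moreover have "uscale 2 1 = 2" using uscale_of_nat[of 2] by simp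
  ultimately have "uscale (1/2) 1 * 2 = 1" by (simp add: uscale_1)
  then have "upoly_const (uscale (1/2) 1 * 2) = upoly_const 1" by (rule arg_cong)
  then have "upoly_const (uscale (1/2) 1) * 2 = 1"
    unfolding upoly_const_simps(2,5,7) .
  then have "y = upoly_const (uscale (1/2) 1) * (2 * y)"
    unfolding mult.assoc[symmetric] by simp
  also have "\<dots> \<in> centralizer UNIV"
    by (intro centralizer_mult upoly_const_uscale_central assms)
  finally show ?thesis .
qed

text \<open>\<open>continuant_in_subring\<close> is applied in the commutative ring
  \<open>weight_zero\<close>, where \<open>Z\<close> consists of the elements that commute with all
  polynomials over the enveloping algebra.\<close>

lemma shifted_det_central:
  assumes l: "l1 - l2 = of_nat m"
  shows "shifted_det l1 l2 m \<in> centralizer UNIV"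
proof -
  let ?x = "casimir_x l1 l2 m"
  let ?B = "centralizer (centralizer weight_zero_gens)"
  have gens: "upoly_const (E 1 1) \<in> ?B" "upoly_const (E 2 2) \<in> ?B" "casimir_P \<in> ?B"
    using subset_bicommutant[of weight_zero_gens] by (auto simp: weight_zero_gens_def casimir_P_def)
  have K: "casimir_K \<in> ?B"
    unfolding casimir_K_def upoly_const_simps by (intro centralizer_diff centralizer_1 gens)
  have us: "upoly_const (uscale c (E i i)) = upoly_const (uscale c 1) * upoly_const (E i i)" for c i
    by (metis uscale_eq upoly_const_simps(5))
  have x: "?x \<in> ?B"
    unfolding casimir_x_def upoly_const_simps us
    by (intro centralizer_diff centralizer_add centralizer_mult centralizer_of_nat gens
        central_imp_weight_zero upoly_const_uscale_central upoly_var_central)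
  \<comment> \<open>As \<open>l1 = l2 + m\<close>, both \<open>E 1 1\<close> and
    \<open>E 2 2\<close> get the coefficient \<open>2 * l2 + m\<close>, so apart from
    \<open>u\<close> and scalars only the trace remains.\<close>
  have w: "2 * ?x - of_nat m * casimir_K \<in> centralizer UNIV"
  proof -
    have l1: "l1 = l2 + of_nat m" using l by (simp add: algebra_simps)
    have u: "uscale (l2 + of_nat m) (E 1 1) = uscale l2 (E 1 1) + of_nat m * E 1 1"
      by (simp add: uscale_add_left uscale_of_nat_left)
    have "2 * ?x - of_nat m * casimir_K =
        upoly_const (uscale l2 1) * (upoly_const (E 1 1 + E 2 2) * 2)
        + of_nat m * upoly_const (E 1 1 + E 2 2) + (upoly_var + upoly_var) - of_nat m"
      unfolding casimir_x_def casimir_K_def l1 u upoly_const_simps us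
      by (simp add: algebra_simps mult_2 mult_2_right)
    also have "\<dots> \<in> centralizer UNIV"
      using centralizer_of_nat[of 2 UNIV]
      by (intro centralizer_diff centralizer_add centralizer_mult centralizer_of_nat
          upoly_const_uscale_central upoly_var_central upoly_const_central trace_central) simp
    finally show ?thesis .
  qed
  have Q: "casimir_K\<^sup>2 + 4 * casimir_P \<in> centralizer UNIV"
    using upoly_const_central[OF casimir_central]
    by (simp add: casimir_K_def casimir_P_def upoly_const_simps power2_eq_square)
  define x' K' P' where "x' = Abs_weight_zero ?x" and "K' = Abs_weight_zero casimir_K"
    and "P' = Abs_weight_zero casimir_P"
  have rep: "Rep_weight_zero x' = ?x" "Rep_weight_zero K' = casimir_K" "Rep_weight_zero P' = casimir_P"
    using x K gens(3) by (simp_all add: x'_def K'_def P'_def Abs_weight_zero_inverse)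
  have num: "Rep_weight_zero (numeral k) = numeral k" for k
    using Rep_of_nat[of "numeral k"] by simp
  note reps = plus_weight_zero.rep_eq minus_weight_zero.rep_eq times_weight_zero.rep_eq Rep_of_nat num rep
  have "continuant (of_nat m) x' K' P' (Suc m) \<in> {y. Rep_weight_zero y \<in> centralizer UNIV}"
  proof (rule continuant_in_subring)
    show "K'\<^sup>2 + 4 * P' \<in> {y. Rep_weight_zero y \<in> centralizer UNIV}"
      using Q by (simp add: reps power2_eq_square)
    show "2 * x' - of_nat m * K' \<in> {y. Rep_weight_zero y \<in> centralizer UNIV}"
      using w by (simp add: reps)
    show "y \<in> {y. Rep_weight_zero y \<in> centralizer UNIV}"
      if "2 * y \<in> {y. Rep_weight_zero y \<in> centralizer UNIV}" for y
      using half_central[of "Rep_weight_zero y"] that by (simp only: reps mem_Collect_eq)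
  qed (simp_all add: reps centralizer_diff centralizer_mult centralizer_of_nat)
  then show ?thesis
    by (simp only: mem_Collect_eq Rep_continuant reps shifted_det_eq_continuant)
qed

section \<open>Action on highest weight vectors\<close>

definition eigen :: "(ugl2 \<Rightarrow> complex mat) \<Rightarrow> complex vec \<Rightarrow> ugl2 \<Rightarrow> complex \<Rightarrow> bool" where
  "eigen \<rho> v a c \<longleftrightarrow> \<rho> a *\<^sub>v v = c \<cdot>\<^sub>v v"

definition eigen_upoly :: "(ugl2 \<Rightarrow> complex mat) \<Rightarrow> complex vec \<Rightarrow> (nat \<Rightarrow>\<^sub>0 ugl2) \<Rightarrow> complex poly \<Rightarrow> bool" where
  "eigen_upoly \<rho> v p q \<longleftrightarrow> (\<forall>k. eigen \<rho> v (Poly_Mapping.lookup p k) (coeff q k))"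

text \<open>
  Unlike \<open>eigen_upoly\<close>, this relation is trivially multiplicative, so no convolution of
  coefficients has to be expanded.
\<close>

definition eigen_factor :: "(ugl2 \<Rightarrow> complex mat) \<Rightarrow> complex vec \<Rightarrow> (nat \<Rightarrow>\<^sub>0 ugl2) \<Rightarrow> complex poly \<Rightarrow> bool" where
  "eigen_factor \<rho> v r s \<longleftrightarrow> (\<forall>p q. eigen_upoly \<rho> v p q \<longrightarrow> eigen_upoly \<rho> v (p * r) (q * s))"

lemma smult_mat_mult_vec: "(c \<cdot>\<^sub>m A) *\<^sub>v v = c \<cdot>\<^sub>v (A *\<^sub>v v)"
  if "A \<in> carrier_mat n n" "v \<in> carrier_vec n" for A :: "complex mat"
  using that by (intro eq_vecI) auto

lemma uscale_minus_1: "uscale (- 1) z = - z"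
proof -
  have "z + uscale (- 1) z = uscale (1 + - 1) z" unfolding uscale_add_left uscale_1 ..
  then have "z + uscale (- 1) z = 0" by (simp add: uscale_0)
  then show ?thesis by (simp add: add_eq_0_iff)
qed

context
  fixes n :: nat and \<rho> :: "ugl2 \<Rightarrow> complex mat" and v :: "complex vec"
  assumes rep: "ug_rep n \<rho>" and v: "v \<in> carrier_vec n"
begin

lemma rep_carrier: "\<rho> x \<in> carrier_mat n n"
  using rep by (simp add: ug_rep_def)

lemma eigen_add: "eigen \<rho> v a c \<Longrightarrow> eigen \<rho> v b d \<Longrightarrow> eigen \<rho> v (a + b) (c + d)"
  using rep v rep_carrier[of a] rep_carrier[of b]
  by (simp add: eigen_def ug_rep_def add_mult_distrib_mat_vec[of _ n n] add_smult_distrib_vec)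

lemma eigen_uscale: "eigen \<rho> v a c \<Longrightarrow> eigen \<rho> v (uscale k a) (k * c)"
  using rep v rep_carrier[of a]
  by (simp add: eigen_def ug_rep_def smult_mat_mult_vec[of _ n] smult_smult_assoc)

lemma eigen_minus: "eigen \<rho> v a c \<Longrightarrow> eigen \<rho> v b d \<Longrightarrow> eigen \<rho> v (a - b) (c - d)"
  using eigen_add[of a c "uscale (- 1) b" "- 1 * d"] eigen_uscale[of b d "- 1"]
  by (simp add: uscale_minus_1)

lemma eigen_mult: "eigen \<rho> v a c \<Longrightarrow> eigen \<rho> v b d \<Longrightarrow> eigen \<rho> v (a * b) (c * d)"
  using rep v rep_carrier[of a] rep_carrier[of b]
  by (simp add: eigen_def ug_rep_def assoc_mult_mat_vec[of _ n n _ n] mult_mat_vec[of _ n n]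
      smult_smult_assoc mult.commute)

lemma eigen_1: "eigen \<rho> v 1 1"
  using rep v by (simp add: eigen_def ug_rep_def)

lemma eigen_0: "eigen \<rho> v 0 0"
  using eigen_minus[OF eigen_1 eigen_1] by simp

lemma eigen_upoly_add:
  "eigen_upoly \<rho> v p q \<Longrightarrow> eigen_upoly \<rho> v p' q' \<Longrightarrow> eigen_upoly \<rho> v (p + p') (q + q')"
  by (simp add: eigen_upoly_def lookup_add eigen_add)

lemma eigen_upoly_diff:
  "eigen_upoly \<rho> v p q \<Longrightarrow> eigen_upoly \<rho> v p' q' \<Longrightarrow> eigen_upoly \<rho> v (p - p') (q - q')"
  by (simp add: eigen_upoly_def lookup_minus eigen_minus)

lemma eigen_upoly_1: "eigen_upoly \<rho> v 1 1"
  by (simp add: eigen_upoly_def lookup_one when_def eigen_0 eigen_1)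

lemma eigen_factor_add:
  "eigen_factor \<rho> v r s \<Longrightarrow> eigen_factor \<rho> v r' s' \<Longrightarrow> eigen_factor \<rho> v (r + r') (s + s')"
  by (simp add: eigen_factor_def distrib_left eigen_upoly_add)

lemma eigen_factor_diff:
  "eigen_factor \<rho> v r s \<Longrightarrow> eigen_factor \<rho> v r' s' \<Longrightarrow> eigen_factor \<rho> v (r - r') (s - s')"
  by (simp add: eigen_factor_def right_diff_distrib eigen_upoly_diff)

lemma eigen_factor_mult:
  "eigen_factor \<rho> v r s \<Longrightarrow> eigen_factor \<rho> v r' s' \<Longrightarrow> eigen_factor \<rho> v (r * r') (s * s')"
  unfolding eigen_factor_def mult.assoc[symmetric] by blast

lemma eigen_factor_const: "eigen \<rho> v a c \<Longrightarrow> eigen_factor \<rho> v (upoly_const a) [:c:]"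
  by (simp add: eigen_factor_def eigen_upoly_def lookup_mult_upoly_const)
     (metis eigen_mult mult.commute)

lemma eigen_factor_var: "eigen_factor \<rho> v upoly_var [:0, 1:]"
  by (auto simp: eigen_factor_def eigen_upoly_def lookup_mult_upoly_var coeff_pCons eigen_0
      split: nat.split)

lemma eigen_factor_1: "eigen_factor \<rho> v 1 1"
  by (simp add: eigen_factor_def)

lemma eigen_factor_of_nat: "eigen_factor \<rho> v (of_nat k) (of_nat k)"
proof (induction k)
  case 0
  show ?case using eigen_factor_diff[OF eigen_factor_1 eigen_factor_1] by simp
next
  case (Suc k)
  then show ?case using eigen_factor_add[OF eigen_factor_1 Suc] by simp
qed

text \<open>Being compatible with differences and products, the relation follows the recursion. It
  leads to scalar polynomials, where \<open>continuant_eq_prod\<close> applies.\<close>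

lemma eigen_factor_continuant:
  assumes "eigen_factor \<rho> v M M'" "eigen_factor \<rho> v x x'" "eigen_factor \<rho> v K K'" "eigen_factor \<rho> v P P'"
  shows "eigen_factor \<rho> v (continuant M x K P k) (continuant M' x' K' P' k)"
proof (induction k rule: induct_nat_012)
  case (ge2 k)
  then show ?case
    unfolding continuant.simps
    by (intro eigen_factor_diff eigen_factor_mult eigen_factor_of_nat assms)
qed (simp_all add: eigen_factor_1 assms)

lemma eigen_shifted_det:
  assumes E12: "\<rho> (E 1 2) *\<^sub>v v = 0\<^sub>v n" and E11: "eigen \<rho> v (E 1 1) a" and E22: "eigen \<rho> v (E 2 2) b"
  shows "eigen_upoly \<rho> v (shifted_det l1 l2 m)
    (\<Prod>k\<in>{0..m}. [:(l1 - of_nat k) * a + (l2 + of_nat k) * b - of_nat k, 1:])"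
proof -
  have z: "0 \<cdot>\<^sub>v v = 0\<^sub>v n" using v by (intro eq_vecI) auto
  have "eigen \<rho> v (E 2 1 * E 1 2) (0 * 0)"
  proof -
    have "\<rho> (E 2 1 * E 1 2) *\<^sub>v v = \<rho> (E 2 1) *\<^sub>v (0 \<cdot>\<^sub>v v)"
      using rep v rep_carrier[of "E 2 1"] rep_carrier[of "E 1 2"]
      by (simp add: ug_rep_def assoc_mult_mat_vec[of _ n n _ n] E12 z)
    also have "\<dots> = 0 \<cdot>\<^sub>v (\<rho> (E 2 1) *\<^sub>v v)" using rep_carrier v by (rule mult_mat_vec)
    also have "\<dots> = 0 \<cdot>\<^sub>v v" using rep_carrier[of "E 2 1"] v by (intro eq_vecI) auto
    finally show ?thesis by (simp add: eigen_def)
  qed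
  \<comment> \<open>Moving \<open>E 1 2\<close> to the right, where it annihilates \<open>v\<close>,
    leaves \<open>E 1 1 - E 2 2\<close>.\<close>
  from eigen_add[OF this eigen_minus[OF E11 E22]] have EF: "eigen \<rho> v (E 1 2 * E 2 1) (a - b)"
    unfolding E_commutation(6) by (simp add: algebra_simps)
  let ?x = "[:l1 * a + l2 * b, 1:] - of_nat m"
  have x: "eigen_factor \<rho> v (casimir_x l1 l2 m) ?x"
    using eigen_factor_diff[OF eigen_factor_add[OF eigen_factor_const[OF
      eigen_add[OF eigen_uscale[OF E11, of l1] eigen_uscale[OF E22, of l2]]] eigen_factor_var] eigen_factor_of_nat]
    by (simp add: casimir_x_def)
  \<comment> \<open>The values of \<open>K\<close> and \<open>P\<close> are written as sum and
    negated product of \<open>a - b\<close> and \<open>- 1\<close>, the form in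
    \<open>continuant_eq_prod\<close>.\<close>
  have K: "eigen_factor \<rho> v casimir_K ([:a - b:] + - 1)"
    using eigen_factor_diff[OF eigen_factor_const[OF eigen_minus[OF E11 E22]] eigen_factor_1]
    by (simp add: casimir_K_def upoly_const_simps)
  have P: "eigen_factor \<rho> v casimir_P (- ([:a - b:] * - 1))"
    using eigen_factor_const[OF EF] by (simp add: casimir_P_def)
  have "eigen_factor \<rho> v (shifted_det l1 l2 m)
      (continuant (of_nat m) ?x ([:a - b:] + - 1) (- ([:a - b:] * - 1)) (Suc m))"
    unfolding shifted_det_eq_continuant by (intro eigen_factor_continuant eigen_factor_of_nat x K P)
  also have "continuant (of_nat m) ?x ([:a - b:] + - 1) (- ([:a - b:] * - 1)) (Suc m) =
      (\<Prod>k\<le>m. ?x - of_nat k * [:a - b:] - of_nat (m - k) * - 1)"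
    by (rule continuant_eq_prod)
  \<comment> \<open>The \<open>- m\<close> in \<open>?x\<close> cancels against
    \<open>m - k\<close>, leaving \<open>- k\<close>.\<close>
  also have "\<dots> = (\<Prod>k\<in>{0..m}. [:(l1 - of_nat k) * a + (l2 + of_nat k) * b - of_nat k, 1:])"
  proof (rule prod.cong)
    fix k assume "k \<in> {0..m}"
    then have "of_nat (m - k) = (of_nat m - of_nat k :: complex)" by (simp add: of_nat_diff)
    then show "?x - of_nat k * [:a - b:] - of_nat (m - k) * - 1 =
        [:(l1 - of_nat k) * a + (l2 + of_nat k) * b - of_nat k, 1:]"
      by (simp add: of_nat_poly algebra_simps)
  qed auto
  finally have "eigen_upoly \<rho> v (1 * shifted_det l1 l2 m)
      (1 * (\<Prod>k\<in>{0..m}. [:(l1 - of_nat k) * a + (l2 + of_nat k) * b - of_nat k, 1:]))"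
    unfolding eigen_factor_def using eigen_upoly_1 by blast
  then show ?thesis by simp
qed

end

section \<open>Central elements on irreducible representations\<close>

lemma subspace_vecI:
  assumes "W \<subseteq> carrier_vec n" "0\<^sub>v n \<in> W" "\<And>v w. v \<in> W \<Longrightarrow> w \<in> W \<Longrightarrow> v + w \<in> W"
    and "\<And>c v. v \<in> W \<Longrightarrow> c \<cdot>\<^sub>v v \<in> W"
  shows "VectorSpace.subspace class_ring W (module_vec TYPE(complex) n)"
proof (rule VectorSpace.subspace.intro)
  show vs: "vectorspace class_ring (module_vec TYPE(complex) n)" by (rule vec_vs)
  show "LinearCombinations.submodule class_ring W (module_vec TYPE(complex) n)"
    using vs assms
    by (intro LinearCombinations.submodule.intro) (auto simp: module_vec_simps vectorspace_def)
qed

lemma mat_mult_zero_vec: "A *\<^sub>v 0\<^sub>v n = 0\<^sub>v n" if "A \<in> carrier_mat n n" for A :: "complex mat"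
  using that by (intro eq_vecI) auto

lemma mat_eqI_mult_vec:
  fixes A B :: "complex mat"
  assumes A: "A \<in> carrier_mat n n" and B: "B \<in> carrier_mat n n"
    and eq: "\<And>v. v \<in> carrier_vec n \<Longrightarrow> A *\<^sub>v v = B *\<^sub>v v"
  shows "A = B"
proof (rule eq_matI)
  fix i j assume "i < dim_row B" "j < dim_col B"
  then have ij: "i < n" "j < n" using B by auto
  have "A $$ (i, j) = vec_index (A *\<^sub>v unit_vec n j) i" using A ij by simp
  also have "\<dots> = vec_index (B *\<^sub>v unit_vec n j) i" by (simp only: eq unit_vec_carrier)
  also have "\<dots> = B $$ (i, j)" using B ij by simp
  finally show "A $$ (i, j) = B $$ (i, j)" .
qed (use A B in auto)

text \<open>The eigenspace of \<open>z\<close> for \<open>c\<close> is invariant because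
  \<open>z\<close> is central, and it contains the nonzero vector \<open>v\<close>; irreducibility
  makes it the whole space.\<close>

lemma central_acts_as_scalar:
  assumes irr: "ug_irreducible n \<rho>" and z: "z \<in> ug_center"
    and v: "v \<in> carrier_vec n" "v \<noteq> 0\<^sub>v n" and ev: "eigen \<rho> v z c"
  shows "\<rho> z = c \<cdot>\<^sub>m 1\<^sub>m n"
proof -
  have rep: "ug_rep n \<rho>" using irr by (simp add: ug_irreducible_def)
  note [simp] = rep_carrier[OF rep v(1)]
  let ?W = "{w \<in> carrier_vec n. \<rho> z *\<^sub>v w = c \<cdot>\<^sub>v w}"
  have "VectorSpace.subspace class_ring ?W (module_vec TYPE(complex) n)"
  proof (rule subspace_vecI)
    show "0\<^sub>v n \<in> ?W" by (simp add: mat_mult_zero_vec) (auto intro!: eq_vecI)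
    show "x + y \<in> ?W" if "x \<in> ?W" "y \<in> ?W" for x y
      using that by (auto simp: mult_add_distrib_mat_vec[of _ n n] smult_add_distrib_vec)
    show "k \<cdot>\<^sub>v x \<in> ?W" if "x \<in> ?W" for k x
      using that by (auto simp: mult_mat_vec[of _ n n] smult_smult_assoc mult.commute)
  qed auto
  moreover have "\<rho> x *\<^sub>v w \<in> ?W" if w: "w \<in> ?W" for x w
  proof -
    have "\<rho> z *\<^sub>v (\<rho> x *\<^sub>v w) = \<rho> (z * x) *\<^sub>v w"
      using w rep by (simp add: ug_rep_def assoc_mult_mat_vec[of _ n n _ n])
    also have "z * x = x * z" using z by (simp add: ug_center_def)
    also have "\<rho> (x * z) *\<^sub>v w = \<rho> x *\<^sub>v (\<rho> z *\<^sub>v w)"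
      using w rep by (simp add: ug_rep_def assoc_mult_mat_vec[of _ n n _ n])
    also have "\<dots> = c \<cdot>\<^sub>v (\<rho> x *\<^sub>v w)" using w by (simp add: mult_mat_vec[of _ n n])
    finally show ?thesis using w mult_mat_vec_carrier[of "\<rho> x" n n w] by simp
  qed
  ultimately have "?W = {0\<^sub>v n} \<or> ?W = carrier_vec n"
    using irr unfolding ug_irreducible_def by blast
  moreover have "v \<in> ?W" using v ev by (simp add: eigen_def)
  ultimately have "?W = carrier_vec n" using v by blast
  then have "\<rho> z *\<^sub>v w = (c \<cdot>\<^sub>m 1\<^sub>m n) *\<^sub>v w" if "w \<in> carrier_vec n" for w
    using that smult_mat_mult_vec[OF one_carrier_mat that] by auto
  then show ?thesis by (intro mat_eqI_mult_vec) auto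
qed

text \<open>One realization of positive dimension determines the scalar, through the entry
  \<open>(0, 0)\<close>. Without a realization every scalar would satisfy the defining
  condition.\<close>

lemma harish_chandra_eqI:
  assumes ex: "ug_irreducible n\<^sub>0 \<rho>\<^sub>0" "has_highest_weight n\<^sub>0 \<rho>\<^sub>0 \<mu>"
    and z: "\<And>n \<rho>. ug_irreducible n \<rho> \<Longrightarrow> has_highest_weight n \<rho> \<mu> \<Longrightarrow> \<rho> z = c \<cdot>\<^sub>m 1\<^sub>m n"
  shows "harish_chandra z \<mu> = c"
  unfolding harish_chandra_def
proof (rule the_equality)
  fix d assume d: "\<forall>n \<rho>. ug_irreducible n \<rho> \<and> has_highest_weight n \<rho> \<mu> \<longrightarrow> \<rho> z = d \<cdot>\<^sub>m 1\<^sub>m n"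
  have "n\<^sub>0 > 0" using ex by (simp add: ug_irreducible_def)
  have "d \<cdot>\<^sub>m 1\<^sub>m n\<^sub>0 = c \<cdot>\<^sub>m (1\<^sub>m n\<^sub>0 :: complex mat)" using d z ex by metis
  then have "(d \<cdot>\<^sub>m 1\<^sub>m n\<^sub>0) $$ (0, 0) = (c \<cdot>\<^sub>m (1\<^sub>m n\<^sub>0 :: complex mat)) $$ (0, 0)" by simp
  with \<open>n\<^sub>0 > 0\<close> show "d = c" by simp
qed (use z in blast)

lemma irreducible_shifted_det:
  assumes l: "l1 - l2 = of_nat m" and irr: "ug_irreducible n \<rho>" and hw: "has_highest_weight n \<rho> (a, b)"
  shows "\<rho> (Poly_Mapping.lookup (shifted_det l1 l2 m) k) =
    coeff (\<Prod>k\<in>{0..m}. [:(l1 - of_nat k) * a + (l2 + of_nat k) * b - of_nat k, 1:]) k \<cdot>\<^sub>m 1\<^sub>m n"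
proof -
  obtain v where v: "v \<in> carrier_vec n" "v \<noteq> 0\<^sub>v n" and hwv: "\<rho> (E 1 2) *\<^sub>v v = 0\<^sub>v n"
    "eigen \<rho> v (E 1 1) a" "eigen \<rho> v (E 2 2) b"
    using hw by (auto simp: has_highest_weight_def eigen_def)
  have rep: "ug_rep n \<rho>" using irr by (simp add: ug_irreducible_def)
  show ?thesis
    using eigen_shifted_det[OF rep v(1) hwv] unfolding eigen_upoly_def
    by (intro central_acts_as_scalar[OF irr _ v] lookup_in_ug_center shifted_det_central[OF l]) blast
qed

section \<open>Construction of the irreducible representations\<close>

definition extend_linear :: "('a \<Rightarrow> complex) \<Rightarrow> ('a \<Rightarrow>\<^sub>0 complex) \<Rightarrow> complex" where
  "extend_linear f p = (\<Sum>w\<in>Poly_Mapping.keys p. Poly_Mapping.lookup p w * f w)"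

lemma extend_linear_superset:
  "finite A \<Longrightarrow> Poly_Mapping.keys p \<subseteq> A \<Longrightarrow> extend_linear f p = (\<Sum>w\<in>A. Poly_Mapping.lookup p w * f w)"
  unfolding extend_linear_def by (rule sum.mono_neutral_left) (auto simp: in_keys_iff)

lemma extend_linear_add: "extend_linear f (p + q) = extend_linear f p + extend_linear f q"
proof -
  let ?A = "Poly_Mapping.keys p \<union> Poly_Mapping.keys q"
  have "Poly_Mapping.keys (p + q) \<subseteq> ?A" by (rule keys_add)
  then show ?thesis
    using extend_linear_superset[of ?A _ f]
    by (simp add: lookup_add distrib_right sum.distrib)
qed

lemma extend_linear_single: "extend_linear f (Poly_Mapping.single w c) = c * f w"
  by (simp add: extend_linear_def)

text \<open>The action of \<open>x\<close> on the module of highest weight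
  \<open>(b + N, b)\<close>, in a basis where \<open>E 2 1\<close> sends \<open>v_i\<close> to
  \<open>(i + 1) v_(i+1)\<close> and \<open>E 1 2\<close> sends \<open>v_(i+1)\<close> to
  \<open>(N - i) v_i\<close>.\<close>

definition weight_mat :: "complex \<Rightarrow> nat \<Rightarrow> gl2 \<Rightarrow> complex mat" where
  "weight_mat b N x = Matrix.mat (Suc N) (Suc N) (\<lambda>(i, j).
     (if j = i then entry x 1 1 * (b + of_nat N - of_nat i) + entry x 2 2 * (b + of_nat i) else 0)
     + (if j = Suc i then entry x 1 2 * (of_nat N - of_nat i) else 0)
     + (if Suc j = i then entry x 2 1 * of_nat i else 0))"

lemma weight_mat_carrier: "weight_mat b N x \<in> carrier_mat (Suc N) (Suc N)"
  by (simp add: weight_mat_def)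

text \<open>The formula is uniform up to both ends: at \<open>i = N\<close> the index
  \<open>Suc i\<close> is out of range, at \<open>i = 0\<close> the index \<open>i - 1\<close> is
  truncated, and in both cases the coefficient is 0.\<close>

lemma weight_mat_mult_vec:
  assumes "v \<in> carrier_vec (Suc N)" "i \<le> N"
  shows "vec_index (weight_mat b N x *\<^sub>v v) i =
    (entry x 1 1 * (b + of_nat N - of_nat i) + entry x 2 2 * (b + of_nat i)) * vec_index v i
    + entry x 1 2 * (of_nat N - of_nat i) * vec_index v (Suc i)
    + entry x 2 1 * of_nat i * vec_index v (i - 1)"
proof -
  let ?d = "entry x 1 1 * (b + of_nat N - of_nat i) + entry x 2 2 * (b + of_nat i)"
  let ?u = "entry x 1 2 * (of_nat N - of_nat i)" and ?l = "entry x 2 1 * of_nat i"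
  have "vec_index (weight_mat b N x *\<^sub>v v) i = (\<Sum>k\<in>{0..<Suc N}. weight_mat b N x $$ (i, k) * vec_index v k)"
    using assms weight_mat_carrier[of b N x] by (simp add: scalar_prod_def del: sum.op_ivl_Suc)
  also have "\<dots> = (\<Sum>k\<in>{0..<Suc N}.
      (if k = i then ?d * vec_index v k else 0) + (if k = Suc i then ?u * vec_index v k else 0)
      + (if Suc k = i then ?l * vec_index v k else 0))"
    using assms(2) by (intro sum.cong refl) (simp add: weight_mat_def distrib_right)
  also have "\<dots> = ?d * vec_index v i + (if Suc i < Suc N then ?u * vec_index v (Suc i) else 0)
      + (\<Sum>k\<in>{0..<Suc N}. if Suc k = i then ?l * vec_index v k else 0)"
    using assms(2) by (simp only: sum.distrib sum.delta finite_atLeastLessThan) simp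
  also have "(\<Sum>k\<in>{0..<Suc N}. if Suc k = i then ?l * vec_index v k else 0) = ?l * vec_index v (i - 1)"
  proof (cases i)
    case (Suc k)
    then show ?thesis using assms(2) by (simp del: sum.op_ivl_Suc)
  qed simp
  also have "(if Suc i < Suc N then ?u * vec_index v (Suc i) else 0) = ?u * vec_index v (Suc i)"
    using assms(2) by auto
  finally show ?thesis .
qed

lemma weight_mat_add: "weight_mat b N (x + y) = weight_mat b N x + weight_mat b N y"
  by (rule eq_matI) (auto simp: weight_mat_def algebra_simps)

lemma weight_mat_scale: "weight_mat b N (\<chi> i j. c * x $ i $ j) = c \<cdot>\<^sub>m weight_mat b N x"
  by (rule eq_matI) (auto simp: weight_mat_def algebra_simps)

lemma entry_bracket:
  "entry (x ** y - y ** x) 1 1 = entry x 1 2 * entry y 2 1 - entry y 1 2 * entry x 2 1"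
  "entry (x ** y - y ** x) 1 2 = entry x 1 1 * entry y 1 2 + entry x 1 2 * entry y 2 2
     - entry y 1 1 * entry x 1 2 - entry y 1 2 * entry x 2 2"
  "entry (x ** y - y ** x) 2 1 = entry x 2 1 * entry y 1 1 + entry x 2 2 * entry y 2 1
     - entry y 2 1 * entry x 1 1 - entry y 2 2 * entry x 2 1"
  "entry (x ** y - y ** x) 2 2 = entry x 2 1 * entry y 1 2 - entry y 2 1 * entry x 1 2"
  by (simp_all add: matrix_matrix_mult_def sum_2)

lemma weight_mat_bracket:
  "weight_mat b N x * weight_mat b N y - weight_mat b N y * weight_mat b N x =
    weight_mat b N (x ** y - y ** x)" (is "?A = ?B")
proof (rule mat_eqI_mult_vec)
  let ?G = "weight_mat b N"
  note [simp] = weight_mat_carrier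
  show "?A \<in> carrier_mat (Suc N) (Suc N)" "?B \<in> carrier_mat (Suc N) (Suc N)"
    by (auto intro!: minus_carrier_mat mult_carrier_mat[of _ "Suc N" "Suc N"])
  fix v :: "complex vec" assume v: "v \<in> carrier_vec (Suc N)"
  have Gv: "?G z *\<^sub>v v \<in> carrier_vec (Suc N)" for z
    using v by (intro mult_mat_vec_carrier) auto
  have A: "?A *\<^sub>v v = ?G x *\<^sub>v (?G y *\<^sub>v v) - ?G y *\<^sub>v (?G x *\<^sub>v v)"
    using v by (simp add: minus_mult_distrib_mat_vec[of _ "Suc N" "Suc N"] mult_carrier_mat[of _ "Suc N" "Suc N" _ "Suc N"]
        assoc_mult_mat_vec[of _ "Suc N" "Suc N" _ "Suc N"])
  show "?A *\<^sub>v v = ?B *\<^sub>v v"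
  proof (rule eq_vecI)
    fix i assume "i < dim_vec (?B *\<^sub>v v)"
    then have i: "i \<le> N" by (simp add: weight_mat_def)
    have "vec_index (?A *\<^sub>v v) i = vec_index (?G x *\<^sub>v (?G y *\<^sub>v v)) i - vec_index (?G y *\<^sub>v (?G x *\<^sub>v v)) i"
      unfolding A using i by (simp add: weight_mat_def)
    also have "\<dots> = vec_index (?B *\<^sub>v v) i"
    proof -
      \<comment> \<open>The factor \<open>N - i\<close> stays in front: it vanishes at
        \<open>i = N\<close>, where row \<open>Suc i\<close> does not exist.\<close>
      have up: "(of_nat N - of_nat i) * vec_index (?G z *\<^sub>v v) (Suc i) = (of_nat N - of_nat i) *
          ((entry z 1 1 * (b + of_nat N - of_nat i - 1) + entry z 2 2 * (b + of_nat i + 1)) * vec_index v (Suc i)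
          + entry z 1 2 * (of_nat N - of_nat i - 1) * vec_index v (Suc (Suc i))
          + entry z 2 1 * (of_nat i + 1) * vec_index v i)" for z
      proof (cases "i = N")
        case False
        then have "Suc i \<le> N" using i by simp
        show ?thesis unfolding weight_mat_mult_vec[OF v \<open>Suc i \<le> N\<close>] by (simp add: algebra_simps)
      qed simp
      \<comment> \<open>Likewise the factor \<open>i\<close> covers \<open>i = 0\<close>; at
        \<open>i = 1\<close> the truncated index \<open>i - 2\<close> has coefficient 0.\<close>
      have down: "of_nat i * vec_index (?G z *\<^sub>v v) (i - 1) = of_nat i *
          ((entry z 1 1 * (b + of_nat N - of_nat i + 1) + entry z 2 2 * (b + of_nat i - 1)) * vec_index v (i - 1)
          + entry z 1 2 * (of_nat N - of_nat i + 1) * vec_index v i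
          + entry z 2 1 * (of_nat i - 1) * vec_index v (i - 2))" for z
      proof (cases i)
        case (Suc k)
        have "i - 1 \<le> N" using i by simp
        show ?thesis unfolding weight_mat_mult_vec[OF v \<open>i - 1 \<le> N\<close>] by (simp add: Suc algebra_simps)
      qed simp
      show ?thesis
        unfolding weight_mat_mult_vec[OF Gv i] weight_mat_mult_vec[OF v i] entry_bracket mult.assoc up down
        by (simp add: algebra_simps)
    qed
    finally show "vec_index (?A *\<^sub>v v) i = vec_index (?B *\<^sub>v v) i" .
  qed (simp add: weight_mat_def)
qed

section \<open>Extension to the enveloping algebra\<close>

fun word_mat :: "complex \<Rightarrow> nat \<Rightarrow> gl2 list \<Rightarrow> complex mat" where
  "word_mat b N [] = 1\<^sub>m (Suc N)"
| "word_mat b N (x # xs) = weight_mat b N x * word_mat b N xs"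

lemma word_mat_carrier: "word_mat b N xs \<in> carrier_mat (Suc N) (Suc N)"
  by (induction xs) (auto intro!: mult_carrier_mat weight_mat_carrier)

lemma word_mat_append: "word_mat b N (xs @ ys) = word_mat b N xs * word_mat b N ys"
proof (induction xs)
  case Nil
  then show ?case using left_mult_one_mat[OF word_mat_carrier] by simp
next
  case (Cons x xs)
  then show ?case
    by (simp add: assoc_mult_mat[OF weight_mat_carrier word_mat_carrier word_mat_carrier])
qed

text \<open>Linear extension of \<open>word_mat\<close> to the free algebra, taken entrywise because
  matrices of all sizes share one type and a sum of them would need a zero of the right
  size.\<close>

definition free_rep :: "complex \<Rightarrow> nat \<Rightarrow> free_gl2 \<Rightarrow> complex mat" where
  "free_rep b N p = Matrix.mat (Suc N) (Suc N)
     (\<lambda>ij. extend_linear (\<lambda>w. word_mat b N (letters w) $$ ij) p)"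

lemma free_rep_carrier: "free_rep b N p \<in> carrier_mat (Suc N) (Suc N)"
  by (simp add: free_rep_def)

lemma free_rep_add: "free_rep b N (p + q) = free_rep b N p + free_rep b N q"
  by (rule eq_matI) (auto simp: free_rep_def extend_linear_add)

lemma one_smult_mat: "1 \<cdot>\<^sub>m A = A" for A :: "complex mat"
  by (rule eq_matI) auto

lemma smult_smult_mat: "c \<cdot>\<^sub>m (d \<cdot>\<^sub>m A) = (c * d) \<cdot>\<^sub>m A" for A :: "complex mat"
  by (rule eq_matI) auto

lemma free_rep_single: "free_rep b N (Poly_Mapping.single w c) = c \<cdot>\<^sub>m word_mat b N (letters w)"
  by (rule eq_matI) (use word_mat_carrier[of b N "letters w"] in \<open>auto simp: free_rep_def extend_linear_single\<close>)

lemma free_rep_diff: "free_rep b N (p - q) = free_rep b N p - free_rep b N q"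
proof (rule eq_matI)
  fix i j assume "i < dim_row (free_rep b N p - free_rep b N q)" "j < dim_col (free_rep b N p - free_rep b N q)"
  then have ij: "i < Suc N" "j < Suc N" by (auto simp: free_rep_def)
  have "free_rep b N p $$ (i, j) = (free_rep b N (p - q) + free_rep b N q) $$ (i, j)"
    unfolding free_rep_add[symmetric] by simp
  with ij show "free_rep b N (p - q) $$ (i, j) = (free_rep b N p - free_rep b N q) $$ (i, j)"
    using free_rep_carrier[of b N] by (auto simp: free_rep_def)
qed (auto simp: free_rep_def)

lemma free_rep_mult: "free_rep b N (p * q) = free_rep b N p * free_rep b N q"
proof (induction p rule: poly_mapping_induct_single)
  case (single v c)
  show ?case
  proof (induction q rule: poly_mapping_induct_single)
    case (single w d)
    show ?case
      using word_mat_carrier[of b N "letters v"] word_mat_carrier[of b N "letters w"]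
      by (simp add: mult_single free_rep_single plus_free_word_def word_mat_append
          mult_smult_assoc_mat[of _ "Suc N" "Suc N"] mult_smult_distrib[of _ "Suc N" "Suc N"]
          smult_smult_mat mult.commute)
  next
    case (add p q)
    then show ?case
      by (simp add: distrib_left free_rep_add
          mult_add_distrib_mat[OF free_rep_carrier free_rep_carrier free_rep_carrier])
  qed
next
  case (add p q)
  then show ?case
    by (simp add: distrib_right free_rep_add
        add_mult_distrib_mat[OF free_rep_carrier free_rep_carrier free_rep_carrier])
qed

lemma free_rep_gen: "free_rep b N (free_gen x) = weight_mat b N x"
  using weight_mat_carrier[of b N x] by (simp add: free_gen_def free_rep_single one_smult_mat)

lemma free_rep_scalar: "free_rep b N (Poly_Mapping.single 0 c * p) = c \<cdot>\<^sub>m free_rep b N p"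
  using free_rep_carrier[of b N p]
  by (simp add: free_rep_mult free_rep_single zero_free_word_def mult_smult_assoc_mat[of _ "Suc N" "Suc N"])

lemma diff_eq_zero_mat: "A \<in> carrier_mat n n \<Longrightarrow> A = B \<Longrightarrow> A - B = 0\<^sub>m n n" for A :: "complex mat"
  by (auto simp: minus_r_inv_mat)

text \<open>The three families of relators express that \<open>weight_mat\<close> is additive,
  homogeneous and compatible with brackets.\<close>

lemma free_rep_relator: "r \<in> ug_relators \<Longrightarrow> free_rep b N r = 0\<^sub>m (Suc N) (Suc N)"
proof -
  assume "r \<in> ug_relators"
  then consider x y where "r = free_gen (x + y) - (free_gen x + free_gen y)"
    | c x where "r = free_gen (\<chi> i j. c * x $ i $ j) - Poly_Mapping.single 0 c * free_gen x"
    | x y where "r = free_gen x * free_gen y - free_gen y * free_gen x - free_gen (x ** y - y ** x)"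
    unfolding ug_relators_def by (auto simp: diff_diff_eq)
  then show ?thesis
  proof cases
    case 1
    then show ?thesis
      by (simp only: free_rep_diff free_rep_add free_rep_gen weight_mat_add)
         (intro diff_eq_zero_mat add_carrier_mat weight_mat_carrier refl)
  next
    case 2
    then show ?thesis
      by (simp only: free_rep_diff free_rep_scalar free_rep_gen weight_mat_scale)
         (intro diff_eq_zero_mat smult_carrier_mat weight_mat_carrier refl)
  next
    case 3
    then show ?thesis
      by (simp only: free_rep_diff free_rep_mult free_rep_gen weight_mat_bracket)
         (intro diff_eq_zero_mat weight_mat_carrier refl)
  qed
qed

lemma free_rep_ideal:
  assumes "p \<in> two_sided_ideal ug_relators"
  shows "free_rep b N p = 0\<^sub>m (Suc N) (Suc N)"
  using assms
proof induction
  case zero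
  show ?case by (rule eq_matI) (auto simp: free_rep_def extend_linear_def)
next
  case (gen r p q)
  then show ?case
    using free_rep_carrier[of b N p] free_rep_carrier[of b N q]
    by (simp add: free_rep_mult free_rep_relator)
qed (simp add: free_rep_add)

lift_definition weight_rep :: "complex \<Rightarrow> nat \<Rightarrow> ugl2 \<Rightarrow> complex mat" is free_rep
proof -
  fix b N p q assume "ug_rel p q"
  then have 0: "free_rep b N p - free_rep b N q = 0\<^sub>m (Suc N) (Suc N)"
    by (simp add: ug_rel_def free_rep_diff[symmetric] free_rep_ideal)
  show "free_rep b N p = free_rep b N q"
  proof (rule eq_matI)
    fix i j assume "i < dim_row (free_rep b N q)" "j < dim_col (free_rep b N q)"
    then have "i < Suc N" "j < Suc N" by (auto simp: free_rep_def)
    moreover from this have "(free_rep b N p - free_rep b N q) $$ (i, j) = 0" by (simp add: 0)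
    ultimately show "free_rep b N p $$ (i, j) = free_rep b N q $$ (i, j)" by (simp add: free_rep_def)
  qed (simp_all add: free_rep_def)
qed

lemma ug_rep_weight_rep: "ug_rep (Suc N) (weight_rep b N)"
  unfolding ug_rep_def
proof (intro conjI allI)
  fix x y :: ugl2 and c :: complex
  show "weight_rep b N 1 = 1\<^sub>m (Suc N)"
    by transfer (unfold single_one[symmetric] free_rep_single zero_free_word_def, simp add: one_smult_mat)
  show "weight_rep b N x \<in> carrier_mat (Suc N) (Suc N)"
    by transfer (rule free_rep_carrier)
  show "weight_rep b N (x * y) = weight_rep b N x * weight_rep b N y"
    by transfer (rule free_rep_mult)
  show "weight_rep b N (x + y) = weight_rep b N x + weight_rep b N y"
    by transfer (rule free_rep_add)
  show "weight_rep b N (uscale c x) = c \<cdot>\<^sub>m weight_rep b N x"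
    by transfer (rule free_rep_scalar)
qed

lemma weight_rep_E: "weight_rep b N (E i j) = weight_mat b N (axis i (axis j 1))"
  unfolding E_def by transfer (rule free_rep_gen)

lemma weight_rep_E_vec:
  assumes "v \<in> carrier_vec (Suc N)" "i < Suc N"
  shows "vec_index (weight_rep b N (E 1 1) *\<^sub>v v) i = (b + of_nat N - of_nat i) * vec_index v i"
    and "vec_index (weight_rep b N (E 2 2) *\<^sub>v v) i = (b + of_nat i) * vec_index v i"
    and "vec_index (weight_rep b N (E 1 2) *\<^sub>v v) i = (of_nat N - of_nat i) * vec_index v (Suc i)"
    and "vec_index (weight_rep b N (E 2 1) *\<^sub>v v) i = of_nat i * vec_index v (i - 1)"
  unfolding weight_rep_E weight_mat_mult_vec[OF assms(1) assms(2)[unfolded less_Suc_eq_le]] by (simp_all add: axis_def)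

lemma weight_rep_carrier: "weight_rep b N x \<in> carrier_mat (Suc N) (Suc N)"
  using ug_rep_weight_rep by (simp add: ug_rep_def)

section \<open>Highest weight and irreducibility\<close>

lemma weight_rep_highest_weight: "has_highest_weight (Suc N) (weight_rep b N) (b + of_nat N, b)"
  unfolding has_highest_weight_def
proof (intro bexI conjI)
  let ?e = "unit_vec (Suc N) 0 :: complex vec"
  note dim = carrier_matD(1)[OF weight_rep_carrier]
  show "?e \<noteq> 0\<^sub>v (Suc N)" by simp
  show "weight_rep b N (E 1 2) *\<^sub>v ?e = 0\<^sub>v (Suc N)"
  proof (rule eq_vecI)
    fix i assume "i < dim_vec (0\<^sub>v (Suc N) :: complex vec)"
    then show "vec_index (weight_rep b N (E 1 2) *\<^sub>v ?e) i = vec_index (0\<^sub>v (Suc N)) i"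
      by (cases "i = N") (simp_all add: weight_rep_E_vec del: index_mult_mat_vec)
  qed (simp add: dim)
  show "weight_rep b N (E 1 1) *\<^sub>v ?e = fst (b + of_nat N, b) \<cdot>\<^sub>v ?e"
    by (rule eq_vecI) (auto simp: dim weight_rep_E_vec simp del: index_mult_mat_vec)
  show "weight_rep b N (E 2 2) *\<^sub>v ?e = snd (b + of_nat N, b) \<cdot>\<^sub>v ?e"
    by (rule eq_vecI) (auto simp: dim weight_rep_E_vec simp del: index_mult_mat_vec)
qed simp

text \<open>From a nonzero vector of an invariant subspace, \<open>E 1 2\<close> leads to a nonzero
  multiple of the highest weight vector, and from there \<open>E 2 1\<close> produces every basis
  vector.\<close>

lemma weight_rep_irreducible: "ug_irreducible (Suc N) (weight_rep b N)"
  unfolding ug_irreducible_def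
proof (intro conjI allI impI ug_rep_weight_rep)
  fix W assume sub: "VectorSpace.subspace class_ring W (module_vec TYPE(complex) (Suc N))"
    and inv: "\<forall>x. \<forall>w\<in>W. weight_rep b N x *\<^sub>v w \<in> W"
  let ?e = "unit_vec (Suc N) :: nat \<Rightarrow> complex vec"
  have sm: "LinearCombinations.submodule class_ring W (module_vec TYPE(complex) (Suc N))"
    using sub by (rule VectorSpace.subspace.submod)
  have W: "w \<in> carrier_vec (Suc N)" if "w \<in> W" for w
    using LinearCombinations.submodule.subset[OF sm] that by (auto simp: module_vec_simps)
  have zero: "0\<^sub>v (Suc N) \<in> W"
    using LinearCombinations.submodule.zero_closed[OF sm] by (simp add: module_vec_simps)
  have add: "v + w \<in> W" if "v \<in> W" "w \<in> W" for v w
    using LinearCombinations.submodule.m_closed[OF sm that] by (simp add: module_vec_simps)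
  have smult: "c \<cdot>\<^sub>v w \<in> W" if "w \<in> W" for c w
    using LinearCombinations.submodule.smult_closed[OF sm _ that] by (simp add: module_vec_simps class_ring_simps)
  note dim = carrier_matD(1)[OF weight_rep_carrier]
  \<comment> \<open>Here \<open>k\<close> is the largest index of a nonzero coordinate. Applying
    \<open>E 1 2\<close> lowers it by one.\<close>
  have lower: "?e 0 \<in> W" if "w \<in> W" "k \<le> N" "vec_index w k \<noteq> 0" "\<And>i. k < i \<Longrightarrow> i \<le> N \<Longrightarrow> vec_index w i = 0" for w k
    using that
  proof (induction k arbitrary: w)
    case 0
    then have "?e 0 = (1 / vec_index w 0) \<cdot>\<^sub>v w"
      using W[of w] by (intro eq_vecI) (auto simp: less_Suc_eq_le)
    then show ?case using smult 0 by simp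
  next
    case (Suc k)
    have w: "w \<in> carrier_vec (Suc N)" using Suc.prems W by blast
    show ?case
    proof (rule Suc.IH)
      show "weight_rep b N (E 1 2) *\<^sub>v w \<in> W" using inv Suc.prems by blast
      have "(of_nat N - of_nat k :: complex) \<noteq> 0" using Suc.prems(2) by simp
      then show "vec_index (weight_rep b N (E 1 2) *\<^sub>v w) k \<noteq> 0"
        using Suc.prems by (simp add: weight_rep_E_vec[OF w] del: index_mult_mat_vec)
      show "vec_index (weight_rep b N (E 1 2) *\<^sub>v w) i = 0" if "k < i" "i \<le> N" for i
      proof (cases "i = N")
        case False
        then show ?thesis using that Suc.prems(4)[of "Suc i"] by (simp add: weight_rep_E_vec[OF w] del: index_mult_mat_vec)
      qed (simp add: weight_rep_E_vec[OF w] del: index_mult_mat_vec)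
    qed (use Suc.prems in simp)
  qed
  show "W = {0\<^sub>v (Suc N)} \<or> W = carrier_vec (Suc N)"
  proof (cases "W = {0\<^sub>v (Suc N)}")
    case False
    then obtain w where w: "w \<in> W" "w \<noteq> 0\<^sub>v (Suc N)" using zero by blast
    let ?I = "{i. i \<le> N \<and> vec_index w i \<noteq> 0}"
    have ne: "?I \<noteq> {}"
    proof
      assume "?I = {}"
      then have "w = 0\<^sub>v (Suc N)" using W[OF w(1)] by (intro eq_vecI) (auto simp: less_Suc_eq_le)
      then show False using w by simp
    qed
    have fin: "finite ?I" by simp
    have "?e 0 \<in> W"
    proof (rule lower[OF w(1)])
      show "Max ?I \<le> N" "vec_index w (Max ?I) \<noteq> 0" using Max_in[OF fin ne] by blast+
      show "vec_index w i = 0" if "Max ?I < i" "i \<le> N" for i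
        using Max_ge[OF fin, of i] that by (metis (mono_tags, lifting) leD mem_Collect_eq)
    qed
    have e: "?e k \<in> W" if "k \<le> N" for k
      using that
    proof (induction k)
      case (Suc k)
      \<comment> \<open>\<open>E 2 1\<close> multiplies by \<open>k + 1\<close> while passing to the
        next basis vector.\<close>
      have "?e (Suc k) = (1 / of_nat (Suc k)) \<cdot>\<^sub>v (weight_rep b N (E 2 1) *\<^sub>v ?e k)"
        using Suc.prems
        by (intro eq_vecI) (auto simp: dim weight_rep_E_vec simp del: of_nat_Suc index_mult_mat_vec)
      then show ?case using smult inv Suc by simp
    qed (use \<open>?e 0 \<in> W\<close> in simp)
    have "v \<in> W" if v: "v \<in> carrier_vec (Suc N)" for v
    proof -
      \<comment> \<open>The vector \<open>v\<close> is assembled coordinate by coordinate; at stage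
        \<open>k\<close> its first \<open>k\<close> coordinates are in place.\<close>
      have "vec (Suc N) (\<lambda>i. if i < k then vec_index v i else 0) \<in> W" if "k \<le> Suc N" for k
        using that
      proof (induction k)
        case 0
        have "vec (Suc N) (\<lambda>i. if i < 0 then vec_index v i else 0) = 0\<^sub>v (Suc N)" by auto
        then show ?case using zero by simp
      next
        case (Suc k)
        have "vec (Suc N) (\<lambda>i. if i < Suc k then vec_index v i else 0) =
            vec (Suc N) (\<lambda>i. if i < k then vec_index v i else 0) + vec_index v k \<cdot>\<^sub>v ?e k"
        proof (rule eq_vecI)
          fix i assume "i < dim_vec (vec (Suc N) (\<lambda>i. if i < k then vec_index v i else 0) + vec_index v k \<cdot>\<^sub>v ?e k)"
          then have "i < Suc N" by simp
          then show "vec_index (vec (Suc N) (\<lambda>i. if i < Suc k then vec_index v i else 0)) i =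
              vec_index (vec (Suc N) (\<lambda>i. if i < k then vec_index v i else 0) + vec_index v k \<cdot>\<^sub>v ?e k) i"
            using Suc.prems by (cases i k rule: linorder_cases) simp_all
        qed simp
        then show ?case using add smult e Suc by simp
      qed
      from this[of "Suc N"] have "vec (Suc N) (\<lambda>i. if i < Suc N then vec_index v i else 0) \<in> W" by simp
      moreover have "vec (Suc N) (\<lambda>i. if i < Suc N then vec_index v i else 0) = v"
        using v by (intro eq_vecI) auto
      ultimately show ?thesis by simp
    qed
    then show ?thesis using W by blast
  qed simp
qed simp

theorem proposition4p1:
  fixes l1 l2 :: complex and m :: nat
  assumes "l1 - l2 = of_nat m"
  shows "(\<forall>n. Poly_Mapping.lookup (shifted_det l1 l2 m) n \<in> ug_center) \<and>
    (\<forall>\<mu>1 \<mu>2 :: complex. \<mu>1 - \<mu>2 \<in> \<nat> \<longrightarrow>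
      (\<forall>n. harish_chandra (Poly_Mapping.lookup (shifted_det l1 l2 m) n) (\<mu>1, \<mu>2) =
        coeff (\<Prod>k\<in>{0..m}.
          [: (l1 - of_nat k) * \<mu>1 + (l2 + of_nat k) * \<mu>2 - of_nat k, 1 :]) n))"
proof (intro conjI allI impI)
  show "Poly_Mapping.lookup (shifted_det l1 l2 m) n \<in> ug_center" for n
    by (intro lookup_in_ug_center shifted_det_central assms)
next
  fix \<mu>1 \<mu>2 :: complex and n
  assume "\<mu>1 - \<mu>2 \<in> \<nat>"
  then obtain N where "\<mu>1 - \<mu>2 = of_nat N" by (elim Nats_cases)
  then have N: "\<mu>1 = \<mu>2 + of_nat N" by (simp add: algebra_simps)
  show "harish_chandra (Poly_Mapping.lookup (shifted_det l1 l2 m) n) (\<mu>1, \<mu>2) =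
      coeff (\<Prod>k\<in>{0..m}.
        [: (l1 - of_nat k) * \<mu>1 + (l2 + of_nat k) * \<mu>2 - of_nat k, 1 :]) n"
    \<comment> \<open>The module with \<open>b = \<mu>2\<close> and
      \<open>N = \<mu>1 - \<mu>2\<close> is the realization that makes the Harish-Chandra value well
      defined.\<close>
    using weight_rep_highest_weight[of N \<mu>2]
    by (intro harish_chandra_eqI[OF weight_rep_irreducible[of N \<mu>2]]
        irreducible_shifted_det[OF assms]) (auto simp: N)
qed

end
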